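(* Let $n>1$ and $\mathcal{D}=\mathbb{C}[D_1,\dots,D_n]$. The $\mathcal{D}$-modules $\mathcal{C}^\infty(\mathsf{T})[x_1,\dots,x_n]$ and $\mathcal{C}^\infty(\mathsf{PT})[x_1,\dots,x_n]$ are not divisible (and therefore not injective).
   Context: $\mathcal{D}=\mathbb{C}[D_1,\dots,D_n]$ is the commutative polynomial ring of constant coefficient differential operators on $\mathbb{R}^n$, with $D_j=\frac{1}{\imath}\frac{\partial}{\partial x_j}$. $\mathcal{C}^\infty(\mathsf{T})$ is the space of smooth functions $\mathbb{R}^n\to\mathbb{C}$ periodic with respect to $2\pi\mathbb{Z}^n$. $\mathcal{C}^\infty(\mathsf{PT})=\bigcup_{N\ge 1}\mathcal{C}^\infty(\mathbb{R}^n/2\pi N\mathbb{Z}^n)$ is the space of smooth functions $\mathbb{R}^n\to\mathbb{C}$ periodic with respect to $2\pi N\mathbb{Z}^n$ for some integer $N\ge 1$ depending on the function. The notation $[x_1,\dots,x_n]$ denotes the subalgebra of $\mathcal{C}^\infty(\mathbb{R}^n)$ obtained by adjoining the coordinate functions. A $\mathcal{D}$-module $E$ is divisible if every nonzero $L\in\mathcal{D}$ acts surjectively on $E$. *)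

theory Defs
  imports
    "HOL-Analysis.Analysis"
    "HOL-Algebra.Module"
    "HOL-Algebra.Algebraic_Closure_Type"
    "HOL-Library.Poly_Mapping"
begin

section \<open>Smooth functions and partial derivatives\<close>

definition partial_deriv :: "'n \<Rightarrow> (real ^ 'n \<Rightarrow> complex) \<Rightarrow> real ^ 'n \<Rightarrow> complex" where
  "partial_deriv j f = (\<lambda>x. vector_derivative (\<lambda>t. f (x + t *\<^sub>R axis j 1)) (at 0))"

primrec C_k :: "nat \<Rightarrow> (real ^ 'n::finite \<Rightarrow> complex) \<Rightarrow> bool" where
  "C_k 0 f \<longleftrightarrow> continuous_on UNIV f"
| "C_k (Suc k) f \<longleftrightarrow> (\<forall>x. f differentiable (at x)) \<and> (\<forall>j. C_k k (partial_deriv j f))"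

definition Cinf :: "(real ^ 'n::finite \<Rightarrow> complex) set" where
  "Cinf = {f. \<forall>k. C_k k f}"

section \<open>The ring of constant coefficient differential operators\<close>

text \<open>A polynomial in the variables \<open>D\<^sub>j\<close>, \<open>j :: 'n\<close>, is a finitely supported map from
  exponent vectors to complex coefficients; multiplication on this type is convolution.\<close>

type_synonym 'n diffop = "('n \<Rightarrow>\<^sub>0 nat) \<Rightarrow>\<^sub>0 complex"

abbreviation diffop_ring :: "'n diffop ring" where
  "diffop_ring \<equiv> ring_of_type_algebra"

definition D :: "'n \<Rightarrow> (real ^ 'n \<Rightarrow> complex) \<Rightarrow> real ^ 'n \<Rightarrow> complex" where
  "D j f = (\<lambda>x. (1 / \<i>) * partial_deriv j f x)"

text \<open>An arbitrary enumeration of the coordinates; on smooth functions the \<open>D\<^sub>j\<close> commute, so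
  the choice does not matter.\<close>

definition coords :: "'n::finite list" where
  "coords = (SOME js. distinct js \<and> set js = UNIV)"

definition D_monom :: "('n::finite \<Rightarrow>\<^sub>0 nat) \<Rightarrow> (real ^ 'n \<Rightarrow> complex) \<Rightarrow> real ^ 'n \<Rightarrow> complex" where
  "D_monom \<alpha> f = foldr (\<lambda>j. D j ^^ Poly_Mapping.lookup \<alpha> j) coords f"

definition act :: "'n::finite diffop \<Rightarrow> (real ^ 'n \<Rightarrow> complex) \<Rightarrow> real ^ 'n \<Rightarrow> complex" where
  "act L f = (\<lambda>x. \<Sum>\<alpha>\<in>Poly_Mapping.keys L. Poly_Mapping.lookup L \<alpha> * D_monom \<alpha> f x)"

section \<open>The function spaces\<close>

definition periodic :: "nat \<Rightarrow> (real ^ 'n::finite \<Rightarrow> complex) \<Rightarrow> bool" where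
  "periodic N f \<longleftrightarrow> (\<forall>(k :: int ^ 'n) x. f (x + (\<chi> j. 2 * pi * real N * real_of_int (k $ j))) = f x)"

definition Cinf_T :: "(real ^ 'n::finite \<Rightarrow> complex) set" where
  "Cinf_T = {f \<in> Cinf. periodic 1 f}"

definition Cinf_PT :: "(real ^ 'n::finite \<Rightarrow> complex) set" where
  "Cinf_PT = (\<Union>N\<in>{1..}. {f \<in> Cinf. periodic N f})"

definition subalgebra_Cinf :: "(real ^ 'n::finite \<Rightarrow> complex) set \<Rightarrow> bool" where
  "subalgebra_Cinf S \<longleftrightarrow> S \<subseteq> Cinf \<and> (\<forall>c. (\<lambda>_. c) \<in> S) \<and>
     (\<forall>f\<in>S. \<forall>g\<in>S. (\<lambda>x. f x + g x) \<in> S) \<and> (\<forall>f\<in>S. \<forall>g\<in>S. (\<lambda>x. f x * g x) \<in> S)"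

definition adjoin_coords :: "(real ^ 'n::finite \<Rightarrow> complex) set \<Rightarrow> (real ^ 'n \<Rightarrow> complex) set" where
  "adjoin_coords A = subalgebra_Cinf hull (A \<union> range (\<lambda>j x. complex_of_real (x $ j)))"

definition diffop_module ::
    "(real ^ 'n::finite \<Rightarrow> complex) set \<Rightarrow> ('n diffop, real ^ 'n \<Rightarrow> complex) module" where
  "diffop_module A = \<lparr>carrier = A, mult = (\<lambda>f g x. f x * g x), one = (\<lambda>_. 1),
     zero = (\<lambda>_. 0), add = (\<lambda>f g x. f x + g x), smult = act\<rparr>"

section \<open>Divisible and injective modules\<close>

definition divisible_module :: "('r, 'c) ring_scheme \<Rightarrow> ('r, 'a, 'd) module_scheme \<Rightarrow> bool" where
  "divisible_module R E \<longleftrightarrow>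
     (\<forall>L \<in> carrier R - {\<zero>\<^bsub>R\<^esub>}. (\<lambda>e. L \<odot>\<^bsub>E\<^esub> e) ` carrier E = carrier E)"

definition mod_hom ::
    "('r, 'c) ring_scheme \<Rightarrow> ('r, 'a, 'd) module_scheme \<Rightarrow> ('r, 'b, 'e) module_scheme \<Rightarrow> ('a \<Rightarrow> 'b) set" where
  "mod_hom R M N = {f \<in> carrier M \<rightarrow> carrier N.
     (\<forall>x\<in>carrier M. \<forall>y\<in>carrier M. f (x \<oplus>\<^bsub>M\<^esub> y) = f x \<oplus>\<^bsub>N\<^esub> f y) \<and>
     (\<forall>a\<in>carrier R. \<forall>x\<in>carrier M. f (a \<odot>\<^bsub>M\<^esub> x) = a \<odot>\<^bsub>N\<^esub> f x)}"

text \<open>Since HOL cannot quantify over types, the extension property is tested against modules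
  whose carriers are subsets of the type \<open>'m\<close>. Failure of the property for one type \<open>'m\<close> is
  failure of injectivity in the usual sense, and it carries over to every larger type; see
  \<open>injective_module_mono\<close> below.\<close>

definition injective_module ::
    "'m itself \<Rightarrow> ('r, 'c) ring_scheme \<Rightarrow> ('r, 'a, 'd) module_scheme \<Rightarrow> bool" where
  "injective_module (_ :: 'm itself) R E \<longleftrightarrow>
     (\<forall>(M :: ('r, 'm) module) (N :: ('r, 'm) module).
        Module.module R M \<longrightarrow> Module.module R N \<longrightarrow>
        (\<forall>i \<in> mod_hom R M N. inj_on i (carrier M) \<longrightarrow>
          (\<forall>g \<in> mod_hom R M E. \<exists>h \<in> mod_hom R N E. \<forall>x\<in>carrier M. h (i x) = g x)))"

context
  fixes \<iota> :: "'k \<Rightarrow> 'm"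
  assumes inj: "inj \<iota>"
begin

private definition transport :: "('r, 'k) module \<Rightarrow> ('r, 'm) module" where
  "transport M = \<lparr>carrier = \<iota> ` carrier M,
     mult = (\<lambda>x y. \<iota> (inv_into UNIV \<iota> x \<otimes>\<^bsub>M\<^esub> inv_into UNIV \<iota> y)), one = \<iota> \<one>\<^bsub>M\<^esub>, zero = \<iota> \<zero>\<^bsub>M\<^esub>,
     add = (\<lambda>x y. \<iota> (inv_into UNIV \<iota> x \<oplus>\<^bsub>M\<^esub> inv_into UNIV \<iota> y)), smult = (\<lambda>a x. \<iota> (a \<odot>\<^bsub>M\<^esub> inv_into UNIV \<iota> x))\<rparr>"

private lemma transport_module:
  assumes "Module.module R M"
  shows "Module.module R (transport M)"
proof -
  interpret Module.module R M by fact
  have [simp]: "inv_into UNIV \<iota> (\<iota> x) = x" for x using inj by simp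
  show ?thesis
  proof (rule moduleI)
    show "abelian_group (transport M)"
    proof (rule abelian_groupI)
      fix x assume "x \<in> carrier (transport M)"
      then obtain y where y: "y \<in> carrier M" "x = \<iota> y" by (auto simp: transport_def)
      then show "\<exists>y\<in>carrier (transport M). y \<oplus>\<^bsub>transport M\<^esub> x = \<zero>\<^bsub>transport M\<^esub>"
        by (intro bexI[of _ "\<iota> (\<ominus>\<^bsub>M\<^esub> y)"]) (auto simp: transport_def M.l_neg)
    qed (auto simp: transport_def M.a_ac)
  qed (auto simp: transport_def R.is_cring smult_l_distr smult_r_distr smult_assoc1)
qed

lemma injective_module_mono:
  assumes "injective_module TYPE('m) R E"
  shows "injective_module TYPE('k) R E"
  unfolding injective_module_def
proof (intro allI impI ballI)
  fix M N :: "('a, 'k) module" and i g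
  assume M: "Module.module R M" and N: "Module.module R N" and i: "i \<in> mod_hom R M N"
    and inj_i: "inj_on i (carrier M)" and g: "g \<in> mod_hom R M E"
  have [simp]: "inv_into UNIV \<iota> (\<iota> x) = x" for x using inj by simp
  have i': "(\<lambda>x. \<iota> (i (inv_into UNIV \<iota> x))) \<in> mod_hom R (transport M) (transport N)"
    using i by (auto simp: mod_hom_def transport_def)
  have inj': "inj_on (\<lambda>x. \<iota> (i (inv_into UNIV \<iota> x))) (carrier (transport M))"
    using inj_i inj by (auto simp: inj_on_def transport_def)
  have g': "(\<lambda>x. g (inv_into UNIV \<iota> x)) \<in> mod_hom R (transport M) E"
    using g by (auto simp: mod_hom_def transport_def)
  obtain h where h: "h \<in> mod_hom R (transport N) E"
    and hg: "\<forall>x\<in>carrier (transport M). h (\<iota> (i (inv_into UNIV \<iota> x))) = g (inv_into UNIV \<iota> x)"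
    using assms[unfolded injective_module_def, rule_format,
      OF transport_module[OF M] transport_module[OF N] i' inj' g'] by blast
  have "h \<circ> \<iota> \<in> mod_hom R N E"
    using h by (auto simp: mod_hom_def transport_def Pi_iff)
  moreover have "\<forall>x\<in>carrier M. (h \<circ> \<iota>) (i x) = g x"
    using hg by (auto simp: transport_def)
  ultimately show "\<exists>h\<in>mod_hom R N E. \<forall>x\<in>carrier M. h (i x) = g x" by blast
qed

end

end

(*
  Fix two coordinates i, j and take L = D_i - \<alpha> D_j with a Liouville number \<alpha>: there are integer
  frequencies (p_n, q_n) whose symbols \<mu>_n = p_n - \<alpha> q_n are nonzero but decay faster than any
  power. Hence g = \<Sum> \<mu>_n exp(i(p_n x_i + q_n x_j)) is smooth and periodic, while a solution of
  L f = g ought to have all Fourier coefficients equal to 1, against the Riemann-Lebesgue lemma.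

  For f = \<Sum> x^a f_a with f_a of period 2 \<pi> N, this is made precise by integrating along the
  characteristics of L, which gives
    f(s, t - \<alpha> s) = f(0, t) + \<Sum> (exp(i \<mu>_n s) - 1) exp(i q_n t).
  For s = 2 \<pi> N m both sides are polynomial on t + 2 \<pi> N \<int>, with coefficients periodic in t, so the
  polynomial variable may be set to 0. The q_l-th Fourier coefficient in t then satisfies
  \<omega>^m (r(m) - 2 \<pi> N) = r(0) - 2 \<pi> N for all m, with r a polynomial and \<omega> = exp(2 \<pi> i N \<mu>_l) \<noteq> 1,
  which forces r(0) = 2 \<pi> N for all large l.

  An injective module E solves L f = g for every g in E as soon as L is not a zero divisor:
  extend p \<mapsto> p g along multiplication by L.
*)

theory Submission
  imports Defs
begin

section \<open>Smooth functions\<close>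

lemma has_vector_derivative_along_axis:
  assumes "(f has_derivative f') (at (x::real^'n::finite))"
  shows "((\<lambda>t. f (x + t *\<^sub>R axis j 1)) has_vector_derivative f' (axis j 1)) (at 0)"
proof -
  have "((\<lambda>t. x + t *\<^sub>R axis j 1) has_derivative (\<lambda>t. t *\<^sub>R axis j 1)) (at 0)"
    by (auto intro!: derivative_eq_intros)
  from has_derivative_compose[OF this, of f f'] assms
  have "((\<lambda>t. f (x + t *\<^sub>R axis j 1)) has_derivative (\<lambda>t. f' (t *\<^sub>R axis j 1))) (at 0)"
    by simp
  then show ?thesis
    using linear_cmul[OF has_derivative_linear[OF assms]] by (simp add: has_vector_derivative_def)
qed

lemma partial_deriv_has_derivative:
  assumes "(f has_derivative f') (at x)"
  shows "partial_deriv j f x = f' (axis j 1)"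
  unfolding partial_deriv_def
  using has_vector_derivative_along_axis[OF assms] by (rule vector_derivative_at)

lemma partial_deriv_add:
  assumes "f differentiable (at x)" "g differentiable (at x)"
  shows "partial_deriv j (\<lambda>x. f x + g x) x = partial_deriv j f x + partial_deriv j g x"
proof -
  obtain f' g' where "(f has_derivative f') (at x)" "(g has_derivative g') (at x)"
    using assms by (auto simp: differentiable_def)
  note d = this this[THEN partial_deriv_has_derivative]
  show ?thesis
    by (subst partial_deriv_has_derivative[OF has_derivative_add[OF d(1,2)]]) (simp add: d)
qed

lemma partial_deriv_mult:
  assumes "f differentiable (at x)" "g differentiable (at x)"
  shows "partial_deriv j (\<lambda>x. f x * g x) x = f x * partial_deriv j g x + partial_deriv j f x * g x"
proof -
  obtain f' g' where "(f has_derivative f') (at x)" "(g has_derivative g') (at x)"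
    using assms by (auto simp: differentiable_def)
  note d = this this[THEN partial_deriv_has_derivative]
  show ?thesis
    by (subst partial_deriv_has_derivative[OF has_derivative_mult[OF d(1,2)]]) (simp add: d)
qed

lemma partial_deriv_const [simp]: "partial_deriv j (\<lambda>_. c) = (\<lambda>_. 0)"
  by (simp add: partial_deriv_def)

text \<open>Continuity is demanded only at level 0, so the base case recovers it from
  differentiability. The product rule needs this descent, because undifferentiated factors reappear
  one level down.\<close>

lemma C_k_SucD: "C_k (Suc k) f \<Longrightarrow> C_k k f"
proof (induction k arbitrary: f)
  case 0
  then have "continuous (at x) f" for x
    using differentiable_imp_continuous_within by auto
  then show ?case by (simp add: continuous_on_eq_continuous_at)
qed auto

lemma C_k_add:
  "C_k k f \<Longrightarrow> C_k k g \<Longrightarrow> C_k k (\<lambda>x. f x + g x)"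
proof (induction k arbitrary: f g)
  case (Suc k)
  then have "partial_deriv j (\<lambda>x. f x + g x) = (\<lambda>x. partial_deriv j f x + partial_deriv j g x)" for j
    by (auto simp: partial_deriv_add)
  with Suc show ?case by auto
qed (auto intro: continuous_intros)

lemma C_k_mult:
  "C_k k f \<Longrightarrow> C_k k g \<Longrightarrow> C_k k (\<lambda>x. f x * g x)"
proof (induction k arbitrary: f g)
  case (Suc k)
  then have "partial_deriv j (\<lambda>x. f x * g x)
      = (\<lambda>x. f x * partial_deriv j g x + partial_deriv j f x * g x)" for j
    by (auto simp: partial_deriv_mult)
  moreover have "C_k k f" "C_k k g"
    using Suc.prems[THEN C_k_SucD] by auto
  ultimately show ?case
    using Suc by (auto intro!: C_k_add)
qed (auto intro: continuous_intros)

text \<open>Induction on \<open>k\<close> goes through because \<open>S\<close> stays fixed while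
  \<open>f\<close> ranges over it. Constants, coordinates and exponential series become smooth this
  way without formulas for their higher derivatives.\<close>

lemma Cinf_coinduct:
  assumes "f \<in> S"
    and "\<And>f x. f \<in> S \<Longrightarrow> f differentiable (at x)"
    and "\<And>f j. f \<in> S \<Longrightarrow> partial_deriv j f \<in> S"
  shows "f \<in> Cinf"
proof -
  have "C_k k f" if "f \<in> S" for k f
    using that
  proof (induction k arbitrary: f)
    case 0
    have "continuous (at x) f" for x
      using assms(2)[OF 0] differentiable_imp_continuous_within by blast
    then show ?case by (simp add: continuous_on_eq_continuous_at)
  qed (use assms in auto)
  with assms(1) show ?thesis by (auto simp: Cinf_def)
qed

lemma Cinf_differentiable: "f \<in> Cinf \<Longrightarrow> f differentiable (at x)"
  unfolding Cinf_def using C_k.simps(2) by blast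

lemma Cinf_partial_deriv: "f \<in> Cinf \<Longrightarrow> partial_deriv j f \<in> Cinf"
  unfolding Cinf_def using C_k.simps(2) by blast

lemma Cinf_continuous: "f \<in> Cinf \<Longrightarrow> continuous_on S f"
  unfolding Cinf_def using C_k.simps(1) continuous_on_subset by blast

lemma Cinf_const: "(\<lambda>_. c) \<in> Cinf"
  by (rule Cinf_coinduct[of _ "range (\<lambda>c _. c)"]) auto

lemma partial_deriv_coord:
  "partial_deriv k (\<lambda>x. complex_of_real (x $ j)) = (\<lambda>_. if j = k then 1 else 0)"
proof
  fix x :: "real^'a"
  have "((\<lambda>x. complex_of_real (x $ j)) has_derivative (\<lambda>h. complex_of_real (h $ j))) (at x)"
    by (intro bounded_linear_imp_has_derivative bounded_linear_compose[OF bounded_linear_of_real]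
        bounded_linear_vec_nth)
  from partial_deriv_has_derivative[OF this, of k]
  show "partial_deriv k (\<lambda>x. complex_of_real (x $ j)) x = (if j = k then 1 else 0)"
    by (auto simp: axis_def)
qed

lemma Cinf_coord: "(\<lambda>x. complex_of_real (x $ j)) \<in> Cinf"
proof (rule Cinf_coinduct[of _ "range (\<lambda>c _. c) \<union> {\<lambda>x. complex_of_real (x $ j)}"])
  fix f :: "real ^ 'a \<Rightarrow> complex" and x
  assume "f \<in> range (\<lambda>c _. c) \<union> {\<lambda>x. complex_of_real (x $ j)}"
  moreover have "(\<lambda>x::real^'a. complex_of_real (x $ j)) differentiable (at x)"
    by (intro bounded_linear_imp_differentiable bounded_linear_compose[OF bounded_linear_of_real]
        bounded_linear_vec_nth)
  ultimately show "f differentiable (at x)" by auto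
qed (auto simp: partial_deriv_coord)

lemma subalgebra_Cinf_Cinf: "subalgebra_Cinf Cinf"
  using Cinf_const by (auto simp: subalgebra_Cinf_def Cinf_def intro!: C_k_add C_k_mult)

lemma Cinf_add: "f \<in> Cinf \<Longrightarrow> g \<in> Cinf \<Longrightarrow> (\<lambda>x. f x + g x) \<in> Cinf"
  and Cinf_mult: "f \<in> Cinf \<Longrightarrow> g \<in> Cinf \<Longrightarrow> (\<lambda>x. f x * g x) \<in> Cinf"
  using subalgebra_Cinf_Cinf unfolding subalgebra_Cinf_def by auto

lemma Cinf_has_vector_derivative_line:
  assumes "f \<in> Cinf"
  shows "((\<lambda>t. f (x + t *\<^sub>R axis j 1)) has_vector_derivative partial_deriv j f (x + t *\<^sub>R axis j 1)) (at t within S)"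
proof -
  obtain f' where f': "(f has_derivative f') (at (x + t *\<^sub>R axis j 1))"
    using Cinf_differentiable[OF assms] by (auto simp: differentiable_def)
  have "((\<lambda>t. x + t *\<^sub>R axis j 1) has_derivative (\<lambda>t. t *\<^sub>R axis j 1)) (at t within S)"
    by (auto intro!: derivative_eq_intros)
  from has_derivative_compose[OF this f']
  show ?thesis
    using linear_cmul[OF has_derivative_linear[OF f']] partial_deriv_has_derivative[OF f', of j]
    by (simp add: has_vector_derivative_def)
qed

text \<open>Schwarz: write \<open>f\<close> as an integral of \<open>partial_deriv k f\<close> along the \<open>k\<close>-axis and
  differentiate under the integral sign in direction \<open>j\<close>.\<close>

lemma partial_deriv_commute:
  fixes f :: "real ^ 'n::finite \<Rightarrow> complex"
  assumes f: "f \<in> Cinf"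
  shows "partial_deriv j (partial_deriv k f) = partial_deriv k (partial_deriv j f)"
proof
  fix x0 :: "real ^ 'n"
  let ?a = "axis j (1::real)" and ?b = "axis k (1::real)"
  define p where "p s t = x0 + s *\<^sub>R ?a + t *\<^sub>R ?b" for s t
  have contp: "continuous_on S (\<lambda>z. h (p (u z) (v z)))"
    if "h \<in> Cinf" "continuous_on S u" "continuous_on S v" for h S and u v :: "'z::topological_space \<Rightarrow> real"
    unfolding p_def
    by (rule continuous_on_compose2[OF Cinf_continuous[OF that(1), of UNIV]])
       (auto intro!: continuous_intros that)
  have ds: "((\<lambda>s. h (p s t)) has_vector_derivative partial_deriv j h (p s t)) (at s within S)"
    if "h \<in> Cinf" for h s t S
    using Cinf_has_vector_derivative_line[OF that, of "x0 + t *\<^sub>R ?b" j s S]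
    by (simp add: p_def algebra_simps)
  have dt: "((\<lambda>t. h (p s t)) has_vector_derivative partial_deriv k h (p s t)) (at t within S)"
    if "h \<in> Cinf" for h s t S
    using Cinf_has_vector_derivative_line[OF that, of "x0 + s *\<^sub>R ?a" k t S]
    by (simp add: p_def algebra_simps)
  note fk = Cinf_partial_deriv[OF f, of k] and fj = Cinf_partial_deriv[OF f, of j]
  note fjk = Cinf_partial_deriv[OF fk, of j]
  have int: "((\<lambda>t. partial_deriv k f (p s t)) has_integral f (p s t) - f (p s 0)) {0..t}"
    if "0 \<le> t" for s t
    by (rule fundamental_theorem_of_calculus[OF that]) (rule dt[OF f])
  have key: "partial_deriv j f (p 0 t)
      = partial_deriv j f (p 0 0) + integral {0..t} (\<lambda>t. partial_deriv j (partial_deriv k f) (p 0 t))"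
    if t: "0 \<le> t" for t
  proof -
    have "((\<lambda>s. integral (cbox 0 t) (\<lambda>t. partial_deriv k f (p s t))) has_vector_derivative
        integral (cbox 0 t) (\<lambda>t. partial_deriv j (partial_deriv k f) (p 0 t))) (at 0 within UNIV)"
    proof (rule leibniz_rule_vector_derivative)
      show "(\<lambda>t. partial_deriv k f (p s t)) integrable_on cbox 0 t" for s
        using int[OF t] by auto
      have "continuous_on (UNIV \<times> cbox 0 t) (\<lambda>z. partial_deriv j (partial_deriv k f) (p (fst z) (snd z)))"
        by (rule contp[OF fjk]) (auto intro!: continuous_intros)
      then show "continuous_on (UNIV \<times> cbox 0 t) (\<lambda>(s, t). partial_deriv j (partial_deriv k f) (p s t))"
        by (simp add: split_beta)
    qed (auto intro: ds[OF fk])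
    then have "((\<lambda>s. f (p s 0) + integral {0..t} (\<lambda>t. partial_deriv k f (p s t))) has_vector_derivative
        partial_deriv j f (p 0 0) + integral {0..t} (\<lambda>t. partial_deriv j (partial_deriv k f) (p 0 t))) (at 0)"
      by (intro has_vector_derivative_add ds[OF f]) auto
    moreover have "(\<lambda>s. f (p s 0) + integral {0..t} (\<lambda>t. partial_deriv k f (p s t))) = (\<lambda>s. f (p s t))"
      using integral_unique[OF int[OF t]] by auto
    ultimately show ?thesis
      using ds[OF f, of t 0 UNIV] vector_derivative_unique_at by fastforce
  qed
  \<comment> \<open>\<open>key\<close> covers \<open>0 \<le> t\<close> only, so both derivatives in
    \<open>t\<close> are taken at 0 within \<open>{0..1}\<close>, where they are still
    unique.\<close>
  have "continuous_on {0..1} (\<lambda>t. partial_deriv j (partial_deriv k f) (p 0 t))"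
    by (rule contp[OF fjk, of _ "\<lambda>_. 0" "\<lambda>t. t"]) simp_all
  from integral_has_vector_derivative[OF this, of 0]
  have "((\<lambda>t. partial_deriv j f (p 0 0) + integral {0..t} (\<lambda>t. partial_deriv j (partial_deriv k f) (p 0 t)))
      has_vector_derivative 0 + partial_deriv j (partial_deriv k f) (p 0 0)) (at 0 within {0..1})"
    by (rule has_vector_derivative_add[OF has_vector_derivative_const]) auto
  then have "((\<lambda>t. partial_deriv j f (p 0 t))
      has_vector_derivative 0 + partial_deriv j (partial_deriv k f) (p 0 0)) (at 0 within {0..1})"
    by (rule has_vector_derivative_transform[OF _ key, rotated 2]) auto
  moreover have "((\<lambda>t. partial_deriv j f (p 0 t))
      has_vector_derivative partial_deriv k (partial_deriv j f) (p 0 0)) (at 0 within {0..1})"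
    by (rule dt[OF fj])
  ultimately have "0 + partial_deriv j (partial_deriv k f) (p 0 0) = partial_deriv k (partial_deriv j f) (p 0 0)"
    by (rule vector_derivative_unique_within[rotated]) (simp add: trivial_limit_within islimpt_Icc)
  then show "partial_deriv j (partial_deriv k f) x0 = partial_deriv k (partial_deriv j f) x0"
    by (simp add: p_def)
qed

section \<open>The action of differential operators\<close>

lemma D_Cinf: "f \<in> Cinf \<Longrightarrow> D j f \<in> Cinf"
  unfolding D_def by (intro Cinf_mult Cinf_const Cinf_partial_deriv)

lemma D_add: "f \<in> Cinf \<Longrightarrow> g \<in> Cinf \<Longrightarrow> D j (\<lambda>x. f x + g x) = (\<lambda>x. D j f x + D j g x)"
  by (simp add: D_def partial_deriv_add Cinf_differentiable algebra_simps add_divide_distrib)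

lemma D_cmult: "f \<in> Cinf \<Longrightarrow> D j (\<lambda>x. c * f x) = (\<lambda>x. c * D j f x)"
  by (auto simp: D_def partial_deriv_mult Cinf_differentiable fun_eq_iff)

lemma D_commute:
  assumes "f \<in> Cinf"
  shows "D j (D k f) = D k (D j f)"
proof -
  have "D j (D k f) = (\<lambda>x. - partial_deriv j (partial_deriv k f) x)" for j k
    using D_cmult[OF Cinf_partial_deriv[OF assms], of j "1 / \<i>" k]
    by (simp add: D_def)
  then show ?thesis
    by (simp add: partial_deriv_commute[OF assms, of j k])
qed

lemma funpow_D_in:
  assumes "\<And>j f. f \<in> S \<Longrightarrow> D j f \<in> S" "f \<in> S"
  shows "(D j ^^ m) f \<in> S"
  using assms by (induction m) auto

lemma foldr_D_in:
  assumes "\<And>j f. f \<in> S \<Longrightarrow> D j f \<in> S" "f \<in> S"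
  shows "foldr (\<lambda>j. D j ^^ a j) js f \<in> S"
  using assms by (induction js) (auto intro: funpow_D_in)

lemma funpow_D_Cinf: "f \<in> Cinf \<Longrightarrow> (D j ^^ m) f \<in> Cinf"
  by (rule funpow_D_in[OF D_Cinf])

lemma foldr_D_Cinf: "f \<in> Cinf \<Longrightarrow> foldr (\<lambda>j. D j ^^ a j) js f \<in> Cinf"
  by (rule foldr_D_in[OF D_Cinf])

lemma funpow_D_commute:
  assumes "f \<in> Cinf"
  shows "(D j ^^ m) (D k f) = D k ((D j ^^ m) f)"
proof (induction m)
  case (Suc m)
  then show ?case using D_commute[of "(D j ^^ m) f" j k] funpow_D_Cinf[OF assms, of m j] by simp
qed simp

lemma funpow_D_commute_funpow:
  assumes "f \<in> Cinf"
  shows "(D j ^^ m) ((D k ^^ l) f) = (D k ^^ l) ((D j ^^ m) f)"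
proof (induction l)
  case (Suc l)
  then show ?case using funpow_D_commute[of "(D k ^^ l) f" m j k] funpow_D_Cinf[OF assms, of l k] by simp
qed simp

lemma foldr_D_commute:
  assumes "f \<in> Cinf"
  shows "foldr (\<lambda>j. D j ^^ a j) js ((D k ^^ m) f) = (D k ^^ m) (foldr (\<lambda>j. D j ^^ a j) js f)"
proof (induction js)
  case (Cons j js)
  then show ?case
    using funpow_D_commute_funpow[OF foldr_D_Cinf[OF assms, of a js], of "a j" j m k] by simp
qed simp

text \<open>In the induction step the power \<open>b j\<close> of \<open>D j\<close> must pass the
  remaining operators of the first monomial, which \<open>foldr_D_commute\<close> allows.\<close>

lemma foldr_D_plus:
  assumes "f \<in> Cinf"
  shows "foldr (\<lambda>j. D j ^^ (a j + b j)) js f = foldr (\<lambda>j. D j ^^ a j) js (foldr (\<lambda>j. D j ^^ b j) js f)"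
proof (induction js)
  case (Cons j js)
  then show ?case
    using foldr_D_commute[OF foldr_D_Cinf[OF assms, of b js], of a js "b j" j]
    by (simp add: funpow_add)
qed simp

lemma D_monom_in:
  assumes "\<And>j f. f \<in> S \<Longrightarrow> D j f \<in> S" "f \<in> S"
  shows "D_monom \<alpha> f \<in> S"
  unfolding D_monom_def using assms by (rule foldr_D_in)

lemma D_monom_plus: "f \<in> Cinf \<Longrightarrow> D_monom (\<alpha> + \<beta>) f = D_monom \<alpha> (D_monom \<beta> f)"
  by (simp add: D_monom_def lookup_add foldr_D_plus)

lemma D_monom_zero [simp]: "D_monom 0 f = f"
proof -
  have "foldr (\<lambda>j. D j ^^ 0) js f = f" for js
    by (induction js) auto
  then show ?thesis by (simp add: D_monom_def)
qed

lemma funpow_D_add: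
  assumes "f \<in> Cinf" "g \<in> Cinf"
  shows "(D j ^^ m) (\<lambda>x. f x + g x) = (\<lambda>x. (D j ^^ m) f x + (D j ^^ m) g x)"
  by (induction m) (use assms in \<open>auto simp: D_add funpow_D_Cinf\<close>)

lemma funpow_D_cmult:
  assumes "f \<in> Cinf"
  shows "(D j ^^ m) (\<lambda>x. c * f x) = (\<lambda>x. c * (D j ^^ m) f x)"
  by (induction m) (use assms in \<open>auto simp: D_cmult funpow_D_Cinf\<close>)

lemma D_monom_add:
  assumes "f \<in> Cinf" "g \<in> Cinf"
  shows "D_monom \<alpha> (\<lambda>x. f x + g x) = (\<lambda>x. D_monom \<alpha> f x + D_monom \<alpha> g x)"
proof -
  have "foldr (\<lambda>j. D j ^^ a j) js (\<lambda>x. f x + g x)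
      = (\<lambda>x. foldr (\<lambda>j. D j ^^ a j) js f x + foldr (\<lambda>j. D j ^^ a j) js g x)" for js and a :: "'a \<Rightarrow> nat"
    by (induction js) (use assms in \<open>auto simp: funpow_D_add foldr_D_Cinf\<close>)
  then show ?thesis by (simp add: D_monom_def)
qed

lemma D_monom_cmult:
  assumes "f \<in> Cinf"
  shows "D_monom \<alpha> (\<lambda>x. c * f x) = (\<lambda>x. c * D_monom \<alpha> f x)"
proof -
  have "foldr (\<lambda>j. D j ^^ a j) js (\<lambda>x. c * f x)
      = (\<lambda>x. c * foldr (\<lambda>j. D j ^^ a j) js f x)" for js and a :: "'a \<Rightarrow> nat"
    by (induction js) (use assms in \<open>auto simp: funpow_D_cmult foldr_D_Cinf\<close>)
  then show ?thesis by (simp add: D_monom_def)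
qed

lemma D_monom_single:
  fixes j :: "'n::finite"
  shows "D_monom (Poly_Mapping.single j 1) f = D j f"
proof -
  have "foldr (\<lambda>k. D k ^^ (1 when j = k)) js f = (if j \<in> set js then D j f else f)"
    if "distinct js" for js
    using that by (induction js) (auto simp: when_def)
  \<comment> \<open>Finiteness of the index type makes the choice behind \<open>coords\<close>
    meaningful; distinctness ensures that \<open>D j\<close> is applied exactly once.\<close>
  moreover have "distinct (coords :: 'n list) \<and> set (coords :: 'n list) = UNIV"
    unfolding coords_def by (rule someI_ex) (use finite_distinct_list[of "UNIV :: 'n set"] in auto)
  ultimately show ?thesis
    by (simp add: D_monom_def lookup_single)
qed

text \<open>Updating at a fresh key is adding a single term. Linear statements about operators can
  thus be checked on monomials.\<close>

lemma poly_mapping_additive_induct [case_names zero single add]: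
  assumes "P 0" "\<And>\<alpha> c. P (Poly_Mapping.single \<alpha> c)" "\<And>p q. P p \<Longrightarrow> P q \<Longrightarrow> P (p + q)"
  shows "P (p :: 'a \<Rightarrow>\<^sub>0 'b::comm_monoid_add)"
proof (induction p rule: update_induct)
  case (update p a b)
  then have "Poly_Mapping.update a b p = p + Poly_Mapping.single a b"
    by (intro poly_mapping_eqI) (auto simp: lookup_update lookup_add lookup_single in_keys_iff when_def)
  with update assms show ?case by simp
qed (rule assms)

lemma act_plus: "act (L + M) f = (\<lambda>x. act L f x + act M f x)"
  unfolding act_def
  by (rule ext, rule setsum_keys_plus_distrib[where f = "\<lambda>\<alpha> c. c * D_monom \<alpha> f _"])
    (auto simp: algebra_simps)

lemma act_single: "act (Poly_Mapping.single \<alpha> c) f = (\<lambda>x. c * D_monom \<alpha> f x)"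
  by (auto simp: act_def)

lemma act_zero [simp]: "act 0 f = (\<lambda>_. 0)"
  by (simp add: act_def)

lemma act_one [simp]: "act 1 f = f"
  using act_single[of 0 1 f] by simp

lemma act_in:
  assumes "subalgebra_Cinf S" "\<And>j f. f \<in> S \<Longrightarrow> D j f \<in> S" "f \<in> S"
  shows "act L f \<in> S"
proof (induction L rule: poly_mapping_additive_induct)
  case (single \<alpha> c)
  then show ?case
    using assms(1) D_monom_in[OF assms(2,3), of \<alpha>] unfolding act_single subalgebra_Cinf_def by fast
next
  case (add p q)
  then show ?case
    using assms(1) unfolding act_plus subalgebra_Cinf_def by fast
qed (use assms in \<open>auto simp: subalgebra_Cinf_def\<close>)

lemma act_Cinf: "f \<in> Cinf \<Longrightarrow> act L f \<in> Cinf"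
  by (rule act_in[OF subalgebra_Cinf_Cinf D_Cinf])

lemma act_add:
  assumes "f \<in> Cinf" "g \<in> Cinf"
  shows "act L (\<lambda>x. f x + g x) = (\<lambda>x. act L f x + act L g x)"
  using assms by (simp add: act_def D_monom_add sum.distrib algebra_simps)

lemma act_cmult:
  assumes "f \<in> Cinf"
  shows "act L (\<lambda>x. c * f x) = (\<lambda>x. c * act L f x)"
  using assms by (simp add: act_def D_monom_cmult sum_distrib_left algebra_simps)

text \<open>Both sides are additive in \<open>L\<close> and in \<open>M\<close>, which reduces the
  claim to monomials; there convolution adds exponents and \<open>D_monom_plus\<close>
  applies.\<close>

lemma act_mult:
  assumes f: "f \<in> Cinf"
  shows "act (L * M) f = act L (act M f)"
proof (induction L rule: poly_mapping_additive_induct)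
  case (single \<alpha> a)
  show ?case
  proof (induction M rule: poly_mapping_additive_induct)
    case zero
    have "act (Poly_Mapping.single \<alpha> a) (\<lambda>_. 0) = (\<lambda>_. 0)"
      using act_cmult[OF Cinf_const, of _ 0 0] by simp
    then show ?case by simp
  next
    case (single \<beta> b)
    then show ?case
      using D_monom_in[of Cinf f, OF D_Cinf f]
      by (simp add: mult_single act_single D_monom_plus f D_monom_cmult ac_simps)
  next
    case (add p q)
    then show ?case by (simp add: act_plus act_add act_Cinf f distrib_left)
  qed
qed (simp_all add: act_plus distrib_right)

section \<open>The algebra obtained by adjoining the coordinates, as a module\<close>

lemma subalgebra_CinfD:
  assumes "subalgebra_Cinf S"
  shows subalgebra_Cinf_subset: "f \<in> S \<Longrightarrow> f \<in> Cinf"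
    and subalgebra_Cinf_const: "(\<lambda>_. c) \<in> S"
    and subalgebra_Cinf_add: "f \<in> S \<Longrightarrow> g \<in> S \<Longrightarrow> (\<lambda>x. f x + g x) \<in> S"
    and subalgebra_Cinf_mult: "f \<in> S \<Longrightarrow> g \<in> S \<Longrightarrow> (\<lambda>x. f x * g x) \<in> S"
  using assms unfolding subalgebra_Cinf_def by blast+

text \<open>The closure properties pass to the intersection defining the hull. Containment in
  \<open>Cinf\<close> does not come for free: it holds because \<open>Cinf\<close> is itself one of
  the intersected subalgebras.\<close>

lemma subalgebra_adjoin_coords:
  assumes "A \<subseteq> Cinf"
  shows "subalgebra_Cinf (adjoin_coords A)"
proof -
  let ?X = "A \<union> range (\<lambda>j x. complex_of_real (x $ j))"
  have "?X \<subseteq> Cinf"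
    using assms Cinf_coord by auto
  then have "subalgebra_Cinf hull ?X \<subseteq> Cinf"
    by (rule hull_minimal) (rule subalgebra_Cinf_Cinf)
  then show ?thesis
    unfolding adjoin_coords_def subalgebra_Cinf_def[of "_ hull _"]
    unfolding hull_def by (auto simp: subalgebra_Cinf_def)
qed

lemma adjoin_coords_superset: "A \<subseteq> adjoin_coords A"
  using hull_subset[of "A \<union> _" subalgebra_Cinf] by (auto simp: adjoin_coords_def)

text \<open>By the sum and product rules, the elements whose \<open>j\<close>-th derivative stays in
  the algebra form a subalgebra. It contains the generators, so by minimality of the hull it is
  everything.\<close>

lemma adjoin_coords_partial_deriv:
  assumes A: "A \<subseteq> Cinf" "\<And>j f. f \<in> A \<Longrightarrow> partial_deriv j f \<in> A" and f: "f \<in> adjoin_coords A"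
  shows "partial_deriv j f \<in> adjoin_coords A"
proof -
  let ?S = "{f \<in> adjoin_coords A. partial_deriv j f \<in> adjoin_coords A}"
  note sub = subalgebra_CinfD[OF subalgebra_adjoin_coords[OF A(1)]]
  have "subalgebra_Cinf ?S"
    unfolding subalgebra_Cinf_def
  proof (intro conjI allI ballI subsetI)
    fix f g assume fg: "f \<in> ?S" "g \<in> ?S"
    then have diff: "f differentiable (at x)" "g differentiable (at x)" for x
      using sub(1) Cinf_differentiable by blast+
    have "partial_deriv j (\<lambda>x. f x + g x) = (\<lambda>x. partial_deriv j f x + partial_deriv j g x)"
      "partial_deriv j (\<lambda>x. f x * g x) = (\<lambda>x. f x * partial_deriv j g x + partial_deriv j f x * g x)"
      using diff by (auto simp: partial_deriv_add partial_deriv_mult)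
    with fg show "(\<lambda>x. f x + g x) \<in> ?S" "(\<lambda>x. f x * g x) \<in> ?S"
      by (simp_all add: sub(3,4))
  qed (use sub(1,2) in auto)
  moreover have "(\<lambda>x. complex_of_real (x $ k)) \<in> adjoin_coords A" for k
    unfolding adjoin_coords_def by (rule hull_inc) auto
  then have "A \<union> range (\<lambda>j x. complex_of_real (x $ j)) \<subseteq> ?S"
    using adjoin_coords_superset[of A] A(2) sub(2) by (auto simp: partial_deriv_coord)
  ultimately have "adjoin_coords A \<subseteq> ?S"
    unfolding adjoin_coords_def[of A, abs_def] by (intro hull_minimal)
  with f show ?thesis by blast
qed

lemma module_adjoin_coords:
  assumes A: "A \<subseteq> Cinf" "\<And>j f. f \<in> A \<Longrightarrow> partial_deriv j f \<in> A"
  shows "Module.module diffop_ring (diffop_module (adjoin_coords A))"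
proof -
  note alg = subalgebra_adjoin_coords[OF A(1)]
  note sub = subalgebra_CinfD[OF alg]
  have D: "D j f \<in> adjoin_coords A" if "f \<in> adjoin_coords A" for j f
    unfolding D_def by (rule sub(4)[OF sub(2) adjoin_coords_partial_deriv[OF A that]])
  have closed: "act L f \<in> adjoin_coords A" if "f \<in> adjoin_coords A" for L f
    using D that by (rule act_in[OF alg])
  show ?thesis
  proof (rule moduleI)
    show "cring (diffop_ring :: 'a diffop ring)" ..
    show "abelian_group (diffop_module (adjoin_coords A))"
    proof (rule abelian_groupI)
      fix f assume "f \<in> carrier (diffop_module (adjoin_coords A))"
      then have "(\<lambda>x. (-1) * f x) \<in> adjoin_coords A"
        by (intro sub(4)[OF sub(2)]) (simp add: diffop_module_def)
      then show "\<exists>g\<in>carrier (diffop_module (adjoin_coords A)).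
          g \<oplus>\<^bsub>diffop_module (adjoin_coords A)\<^esub> f = \<zero>\<^bsub>diffop_module (adjoin_coords A)\<^esub>"
        by (intro bexI[of _ "\<lambda>x. (-1) * f x"]) (auto simp: diffop_module_def)
    qed (use sub(2,3) in \<open>simp_all add: diffop_module_def algebra_simps\<close>)
  qed (simp_all add: diffop_module_def ring_of_type_algebra_def act_plus act_mult act_add sub(1) closed)
qed

text \<open>Multiplication by \<open>L\<close> embeds the ring, as a module over itself, into
  itself. If \<open>h\<close> extends \<open>p \<mapsto> p e\<close> along it, then
  \<open>L h(1) = h(L) = e\<close>. Both test modules have the ring as carrier, which is why
  injectivity is tested on the type \<open>'r\<close>.\<close>

lemma injective_module_imp_solvable:
  fixes L :: "'r::comm_ring_1" and E :: "('r, 'a) module"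
  assumes inj: "injective_module TYPE('r) ring_of_type_algebra E"
    and E: "Module.module ring_of_type_algebra E"
    and L: "\<And>p. L * p = 0 \<Longrightarrow> p = 0" and e: "e \<in> carrier E"
  shows "\<exists>f \<in> carrier E. L \<odot>\<^bsub>E\<^esub> f = e"
proof -
  interpret E: Module.module "ring_of_type_algebra :: 'r ring" E by (rule E)
  let ?R = "\<lparr>carrier = UNIV, mult = (*), one = 1, zero = 0, add = (+), smult = (*)\<rparr> :: ('r, 'r) module"
  have R: "Module.module ring_of_type_algebra ?R"
  proof (rule moduleI)
    show "abelian_group ?R"
      by (rule abelian_groupI) (auto simp: algebra_simps intro: exI[of _ "- x" for x])
  qed (auto simp: ring_of_type_algebra_def algebra_simps intro: E.R.is_cring[unfolded ring_of_type_algebra_def])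
  have i: "(\<lambda>p. L * p) \<in> mod_hom ring_of_type_algebra ?R ?R"
    by (auto simp: mod_hom_def algebra_simps)
  have "inj_on (\<lambda>p. L * p) (carrier ?R)"
  proof (rule inj_onI)
    fix p q assume "L * p = L * q"
    then have "L * (p - q) = 0" by (simp add: algebra_simps)
    with L show "p = q" by fastforce
  qed
  moreover have "(\<lambda>p. p \<odot>\<^bsub>E\<^esub> e) \<in> mod_hom ring_of_type_algebra ?R E"
    using E.smult_closed[OF _ e] E.smult_l_distr[OF _ _ e] E.smult_assoc1[OF _ _ e]
    by (auto simp: mod_hom_def ring_of_type_algebra_def)
  ultimately obtain h where h: "h \<in> mod_hom ring_of_type_algebra ?R E"
    and hi: "\<forall>p. h (L * p) = p \<odot>\<^bsub>E\<^esub> e"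
    using inj[unfolded injective_module_def, rule_format, OF R R i] by fastforce
  have "L \<odot>\<^bsub>E\<^esub> h 1 = h (L * 1)"
    using h unfolding mod_hom_def ring_of_type_algebra_def by simp (metis mult_1_right)
  also have "\<dots> = e"
    using hi[rule_format, of 1] E.smult_one[OF e] by (simp add: ring_of_type_algebra_def)
  finally show ?thesis
    using h by (auto simp: mod_hom_def)
qed

text \<open>Compare the coefficients of highest degree in the \<open>i\<close>-th variable.\<close>

lemma diffop_nonzero_divisor:
  fixes p :: "'n diffop"
  assumes ij: "i \<noteq> j"
    and p: "(Poly_Mapping.single (Poly_Mapping.single i 1) 1
      + Poly_Mapping.single (Poly_Mapping.single j 1) c) * p = 0"
  shows "p = 0"
proof (rule ccontr)
  let ?i = "Poly_Mapping.single i (1::nat)" and ?j = "Poly_Mapping.single j (1::nat)"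
  have shift: "Poly_Mapping.lookup (Poly_Mapping.single \<beta> c * q) (\<beta> + \<delta>) = c * Poly_Mapping.lookup q \<delta>"
    for \<beta> \<delta> c and q :: "'n diffop"
    by (induction q rule: poly_mapping_additive_induct)
      (auto simp: mult_single lookup_single lookup_add distrib_left when_def)
  assume "p \<noteq> 0"
  have fin: "finite (Poly_Mapping.keys p)" "Poly_Mapping.keys p \<noteq> {}"
    using \<open>p \<noteq> 0\<close> by (auto simp: in_keys_iff poly_mapping_eq_iff fun_eq_iff)
  have "\<exists>\<gamma>\<in>Poly_Mapping.keys p. \<forall>\<delta>\<in>Poly_Mapping.keys p. Poly_Mapping.lookup \<delta> i \<le> Poly_Mapping.lookup \<gamma> i"
    using finite_imageI[OF fin(1), of "\<lambda>\<gamma>. Poly_Mapping.lookup \<gamma> i"] fin(2)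
      Max_in[of "(\<lambda>\<gamma>. Poly_Mapping.lookup \<gamma> i) ` Poly_Mapping.keys p"] Max_ge[of "(\<lambda>\<gamma>. Poly_Mapping.lookup \<gamma> i) ` Poly_Mapping.keys p"]
    by fastforce
  then obtain \<gamma> where \<gamma>: "\<gamma> \<in> Poly_Mapping.keys p" and max: "\<And>\<delta>. \<delta> \<in> Poly_Mapping.keys p \<Longrightarrow> Poly_Mapping.lookup \<delta> i \<le> Poly_Mapping.lookup \<gamma> i"
    by blast
  \<comment> \<open>The second summand could reach this exponent only from a term of
    \<open>p\<close> whose degree in the \<open>i\<close>-th variable exceeds the maximal one by 1.
    The coefficient of the product at \<open>?i + \<gamma>\<close> is therefore that of
    \<open>p\<close> at \<open>\<gamma>\<close>.\<close>
  have "?i + \<gamma> \<notin> Poly_Mapping.keys (Poly_Mapping.single ?j c * p)"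
  proof
    assume "?i + \<gamma> \<in> Poly_Mapping.keys (Poly_Mapping.single ?j c * p)"
    then obtain \<delta> where \<delta>: "\<delta> \<in> Poly_Mapping.keys p" "?i + \<gamma> = ?j + \<delta>"
      using keys_mult[of "Poly_Mapping.single ?j c" p] by (auto split: if_splits)
    then have "Poly_Mapping.lookup (?i + \<gamma>) i = Poly_Mapping.lookup (?j + \<delta>) i" by simp
    with max[OF \<delta>(1)] ij show False by (simp add: lookup_add lookup_single)
  qed
  then have "Poly_Mapping.lookup p \<gamma> = Poly_Mapping.lookup ((Poly_Mapping.single ?i 1 + Poly_Mapping.single ?j c) * p) (?i + \<gamma>)"
    by (simp add: distrib_right lookup_add shift in_keys_iff)
  with p \<gamma> show False by (simp add: in_keys_iff)
qed

section \<open>Termwise differentiation and Fourier coefficients\<close>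

text \<open>The Weierstrass test for derivatives: tails of \<open>M\<close> bound the tails of the
  differentiated series uniformly in \<open>x\<close>, so convergence of the series itself at one
  point \<open>x0\<close> is enough.\<close>

lemma has_derivative_suminf:
  fixes f :: "nat \<Rightarrow> 'a::real_normed_vector \<Rightarrow> 'b::banach"
  assumes der: "\<And>n x. (f n has_derivative f' n x) (at x)"
    and bound: "\<And>n x h. norm (f' n x h) \<le> M n * norm h"
    and M: "summable M" and x0: "summable (\<lambda>n. f n x0)"
  shows "((\<lambda>x. suminf (\<lambda>n. f n x)) has_derivative (\<lambda>h. suminf (\<lambda>n. f' n x h))) (at x)"
proof -
  have sum': "summable (\<lambda>n. f' n x h)" for x h
    using bound summable_mult2[OF M, of "norm h"] by (rule summable_comparison_test'[rotated])
  have "\<exists>g. \<forall>x\<in>UNIV. (\<lambda>n. f n x) sums g x \<and> (g has_derivative (\<lambda>h. suminf (\<lambda>n. f' n x h))) (at x within UNIV)"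
  proof (rule has_derivative_series)
    show "(\<lambda>n. f n x0) sums (suminf (\<lambda>n. f n x0))"
      using x0 by (rule summable_sums)
    fix e :: real assume "e > 0"
    then obtain N where N: "\<And>n. n \<ge> N \<Longrightarrow> norm (suminf (\<lambda>i. M (i + n))) < e"
      using suminf_exist_split[OF _ M] by blast
    show "\<forall>\<^sub>F n in sequentially. \<forall>x\<in>UNIV. \<forall>h.
        norm ((\<Sum>i<n. f' i x h) - (suminf (\<lambda>n. f' n x h))) \<le> e * norm h"
      unfolding eventually_sequentially
    proof (intro exI[of _ N] allI impI ballI)
      fix n x h assume n: "N \<le> n"
      have Mn: "summable (\<lambda>i. M (i + n))"
        using M by (simp add: summable_iff_shift)
      have "norm ((\<Sum>i<n. f' i x h) - (suminf (\<lambda>n. f' n x h))) = norm (suminf (\<lambda>i. f' (i + n) x h))"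
        using suminf_split_initial_segment[OF sum', of x h n] by simp
      also have "\<dots> \<le> (suminf (\<lambda>i. M (i + n) * norm h))"
        by (rule norm_suminf_le[OF bound summable_mult2[OF Mn]])
      also have "\<dots> = (suminf (\<lambda>i. M (i + n))) * norm h"
        by (rule suminf_mult2[symmetric, OF Mn])
      also have "\<dots> \<le> e * norm h"
        using N[OF n] by (intro mult_right_mono) auto
      finally show "norm ((\<Sum>i<n. f' i x h) - (suminf (\<lambda>n. f' n x h))) \<le> e * norm h" .
    qed
  qed (use der in auto)
  then obtain g where g: "\<And>x. (\<lambda>n. f n x) sums g x"
    "\<And>x. (g has_derivative (\<lambda>h. suminf (\<lambda>n. f' n x h))) (at x)"
    by auto
  moreover have "(\<lambda>x. suminf (\<lambda>n. f n x)) = g"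
    using g(1) by (auto simp: sums_iff)
  ultimately show ?thesis by simp
qed

text \<open>Modulo the period the shift is some \<open>r\<close> in \<open>{0..T}\<close>; the piece
  of \<open>{r..r + T}\<close> beyond \<open>T\<close> is then moved back to
  \<open>{0..r}\<close>.\<close>

lemma integral_periodic_shift:
  fixes f :: "real \<Rightarrow> 'a::banach"
  assumes cont: "continuous_on UNIV f" and per: "\<And>t. f (t + T) = f t" and T: "T > 0"
  shows "integral {0..T} (\<lambda>t. f (t + a)) = integral {0..T} f"
proof -
  have per_nat: "f (t + real n * T) = f t" for n t
  proof (induction n)
    case (Suc n)
    then show ?case using per[of "t + real n * T"] by (simp add: algebra_simps)
  qed simp
  have per_int: "f (t + of_int n * T) = f t" for n t
  proof (cases "n \<ge> 0")
    case True
    then show ?thesis using per_nat[of t "nat n"] by simp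
  next
    case False
    then show ?thesis using per_nat[of "t + of_int n * T" "nat (- n)"] by simp
  qed
  define r where "r = a - of_int \<lfloor>a / T\<rfloor> * T"
  have r: "0 \<le> r" "r \<le> T"
    using T floor_divide_lower[OF T, of a] floor_divide_upper[OF T, of a]
    by (auto simp: r_def algebra_simps)
  have int: "f integrable_on {u..v}" for u v
    using cont continuous_on_subset by (intro integrable_continuous_real) blast
  have "(\<lambda>t. f (t + a)) = (\<lambda>t. f (t + r))"
    using per_int[of "t + r" "\<lfloor>a / T\<rfloor>" for t] by (simp add: r_def)
  then have "integral {0..T} (\<lambda>t. f (t + a)) = integral {r..r + T} f"
    using integral_shift_real_ivl[of r r "r + T" f] by simp
  also have "\<dots> = integral {r..T} f + integral {T..r + T} f"
    using r T by (intro Henstock_Kurzweil_Integration.integral_combine[symmetric] int) auto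
  also have "integral {T..r + T} f = integral {0..r} f"
    using integral_shift_real_ivl[of T T "r + T" f] by (simp add: per)
  also have "integral {r..T} f + integral {0..r} f = integral {0..T} f"
    using r by (subst add.commute) (intro Henstock_Kurzweil_Integration.integral_combine int, auto)
  finally show ?thesis .
qed

section \<open>Fourier coefficients of functions of period \<open>2 pi N\<close>\<close>

lemma cis_int_periodic: "cis (of_int m * (t + 2 * pi * real N)) = cis (of_int m * t)"
proof -
  have "cis (of_int m * (t + 2 * pi * real N)) = cis (of_int m * t) * cis (2 * pi * of_int (m * int N))"
    by (simp add: cis_mult algebra_simps)
  also have "cis (2 * pi * of_int (m * int N)) = 1"
    by (rule cis_multiple_2pi) simp
  finally show ?thesis by simp
qed

text \<open>The integral is not divided by the length of the period, so an exponential of frequency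
  \<open>q\<close> has coefficient \<open>2 pi N\<close>. Only integer frequencies are tested,
  although a function of period \<open>2 pi N\<close> may contain fractional ones.\<close>

definition fcoeff :: "nat \<Rightarrow> int \<Rightarrow> (real \<Rightarrow> complex) \<Rightarrow> complex" where
  "fcoeff N q f = integral {0..2 * pi * real N} (\<lambda>t. f t * cis (of_int (- q) * t))"

lemma fcoeff_integrable:
  assumes "continuous_on UNIV f"
  shows "(\<lambda>t. f t * cis (of_int m * t)) integrable_on {0..T}"
  using continuous_on_subset[OF assms, of "{0..T}"]
  by (auto intro!: integrable_continuous_real continuous_intros)

lemma fcoeff_shift:
  assumes cont: "continuous_on UNIV f" and per: "\<And>t. f (t + 2 * pi * real N) = f t" and N: "N > 0"
  shows "fcoeff N q (\<lambda>t. f (t + a)) = cis (of_int q * a) * fcoeff N q f"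
proof -
  have "fcoeff N q (\<lambda>t. f (t + a))
      = integral {0..2 * pi * real N} (\<lambda>t. cis (of_int q * a) * (f (t + a) * cis (of_int (- q) * (t + a))))"
    unfolding fcoeff_def by (intro integral_cong) (simp add: cis_mult[symmetric] algebra_simps cis_mult)
  also have "\<dots> = cis (of_int q * a) * integral {0..2 * pi * real N} (\<lambda>t. f (t + a) * cis (of_int (- q) * (t + a)))"
    by simp
  also have "integral {0..2 * pi * real N} (\<lambda>t. f (t + a) * cis (of_int (- q) * (t + a))) = fcoeff N q f"
    unfolding fcoeff_def
  proof (rule integral_periodic_shift[of "\<lambda>t. f t * cis (of_int (- q) * t)"])
    show "f (t + 2 * pi * real N) * cis (of_int (- q) * (t + 2 * pi * real N)) = f t * cis (of_int (- q) * t)" for t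
      by (simp only: cis_int_periodic per)
  qed (use N in \<open>auto intro!: continuous_intros cont\<close>)
  finally show ?thesis .
qed

text \<open>Riemann-Lebesgue for continuous periodic functions. A shift by
  \<open>h = pi / q n\<close> reverses the sign of the coefficient, so twice the coefficient is that
  of \<open>f t - f (t + h)\<close>, which is small by uniform continuity.\<close>

lemma fcoeff_tendsto_0:
  assumes cont: "continuous_on UNIV f" and per: "\<And>t. f (t + 2 * pi * real N) = f t" and N: "N > 0"
    and q: "filterlim q at_top sequentially"
  shows "(\<lambda>n. fcoeff N (q n) f) \<longlonglongrightarrow> 0"
proof (rule tendstoI)
  fix e :: real assume e: "e > 0"
  define T where "T = 2 * pi * real N"
  have T: "T > 0" using N by (simp add: T_def)
  have "uniformly_continuous_on {0..T + pi} f"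
    using cont continuous_on_subset by (intro compact_uniformly_continuous) (blast | simp)+
  then obtain d where d: "d > 0"
    "\<And>x y. x \<in> {0..T + pi} \<Longrightarrow> y \<in> {0..T + pi} \<Longrightarrow> dist y x < d \<Longrightarrow> dist (f y) (f x) < e / T"
    unfolding uniformly_continuous_on_def using e T by (metis divide_pos_pos)
  \<comment> \<open>The bound \<open>pi / d\<close> makes \<open>h\<close> smaller than
    \<open>d\<close>; the bound 1 gives \<open>h \<le> pi\<close>, so that \<open>t + h\<close>
    stays in \<open>{0..T + pi}\<close>.\<close>
  have "\<forall>\<^sub>F n in sequentially. \<lceil>max 1 (pi / d)\<rceil> + 1 \<le> q n"
    using q by (simp add: filterlim_at_top)
  then show "\<forall>\<^sub>F n in sequentially. dist (fcoeff N (q n) f) 0 < e"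
  proof eventually_elim
    case (elim n)
    then have qn: "real_of_int (q n) > 1" "real_of_int (q n) > pi / d"
      by linarith+
    define h where "h = pi / real_of_int (q n)"
    have h: "0 < h" "h < d" "h \<le> pi" "of_int (q n) * h = pi"
      using qn d(1) by (auto simp: h_def field_simps)
    have "fcoeff N (q n) (\<lambda>t. f (t + h)) = - fcoeff N (q n) f"
      using fcoeff_shift[OF cont per N, of "q n" h] h by simp
    moreover have conth: "continuous_on UNIV (\<lambda>t. f (t + h))"
      by (rule continuous_on_compose2[OF cont]) (auto intro!: continuous_intros)
    note int = fcoeff_integrable[of _ "- q n" T]
    have "fcoeff N (q n) f - fcoeff N (q n) (\<lambda>t. f (t + h))
        = integral {0..T} (\<lambda>t. (f t - f (t + h)) * cis (of_int (- q n) * t))"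
      unfolding fcoeff_def T_def[symmetric]
      using integral_diff[OF int[OF cont] int[OF conth]] by (simp only: left_diff_distrib)
    ultimately have "2 * fcoeff N (q n) f = integral (cbox 0 T) (\<lambda>t. (f t - f (t + h)) * cis (of_int (- q n) * t))"
      by simp
    moreover have "norm (integral (cbox 0 T) (\<lambda>t. (f t - f (t + h)) * cis (of_int (- q n) * t))) \<le> e / T * measure lborel (cbox 0 T)"
    proof (rule integrable_bound)
      show "(\<lambda>t. (f t - f (t + h)) * cis (of_int (- q n) * t)) integrable_on cbox 0 T"
        using int[OF continuous_on_diff[OF cont conth]] by (simp only: cbox_interval)
      show "norm ((f t - f (t + h)) * cis (of_int (- q n) * t)) \<le> e / T" if "t \<in> cbox 0 T" for t
      proof -
        have "dist (f t) (f (t + h)) < e / T"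
          using that h by (intro d(2)) (auto simp: dist_norm)
        then show ?thesis by (simp add: norm_mult dist_norm)
      qed
    qed (use e T in auto)
    ultimately have "norm (2 * fcoeff N (q n) f) \<le> e"
      using T by simp
    then show ?case using e by (simp add: norm_mult)
  qed
qed

lemma integral_cis_int:
  "((\<lambda>t. cis (of_int m * t)) has_integral (if m = 0 then of_real (2 * pi * real N) else 0)) {0..2 * pi * real N}"
proof (cases "m = 0")
  case True
  then show ?thesis
    using has_integral_const_real[of "1 :: complex" 0 "2 * pi * real N"] by (simp add: scaleR_conv_of_real)
next
  case False
  have "((\<lambda>t. cis (of_int m * t) / (\<i> * of_int m)) has_vector_derivative cis (of_int m * t)) (at t within S)" for t S
  proof -
    have "((\<lambda>t. exp (\<i> * of_int m * of_real t) / (\<i> * of_int m)) has_vector_derivative exp (\<i> * of_int m * of_real t)) (at t within S)"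
      using False by (auto intro!: derivative_eq_intros has_vector_derivative_real_field)
    then show ?thesis by (simp add: cis_conv_exp mult.assoc)
  qed
  then have "((\<lambda>t. cis (of_int m * t)) has_integral
      cis (of_int m * (2 * pi * real N)) / (\<i> * of_int m) - cis (of_int m * 0) / (\<i> * of_int m)) {0..2 * pi * real N}"
    by (intro fundamental_theorem_of_calculus) auto
  moreover have "cis (of_int m * (2 * pi * real N)) = cis (of_int m * 0)"
    using cis_int_periodic[of m 0 N] by simp
  ultimately show ?thesis using False by simp
qed

text \<open>Absolute summability gives uniform convergence, hence termwise integration. By
  injectivity of \<open>q\<close> only the \<open>l\<close>-th term has the tested frequency, so the
  integrated partial sums are constant once \<open>n > l\<close>.\<close>

lemma fcoeff_suminf:
  assumes b: "summable (\<lambda>n. norm (b n))" and inj: "inj q"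
  shows "fcoeff N (q l) (\<lambda>t. suminf (\<lambda>n. b n * cis (of_int (q n) * t))) = of_real (2 * pi * real N) * b l"
proof -
  define T where "T = 2 * pi * real N"
  let ?f = "\<lambda>n t. \<Sum>j<n. b j * cis (of_int (q j - q l) * t)"
  let ?g = "\<lambda>t. (suminf (\<lambda>n. b n * cis (of_int (q n) * t))) * cis (of_int (- q l) * t)"
  have "uniform_limit (cbox 0 T) ?f (\<lambda>t. suminf (\<lambda>n. b n * cis (of_int (q n - q l) * t))) sequentially"
    using b by (intro Weierstrass_m_test[where M = "\<lambda>n. norm (b n)"]) (auto simp: norm_mult)
  also have "(\<lambda>t. suminf (\<lambda>n. b n * cis (of_int (q n - q l) * t))) = ?g"
  proof
    fix t
    have "summable (\<lambda>n. b n * cis (of_int (q n) * t))"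
      using b by (intro summable_norm_cancel[of "\<lambda>n. b n * cis (of_int (q n) * t)"]) (simp add: norm_mult)
    from suminf_mult2[OF this, of "cis (of_int (- q l) * t)"]
    show "(suminf (\<lambda>n. b n * cis (of_int (q n - q l) * t))) = ?g t"
      by (simp add: mult.assoc cis_mult algebra_simps)
  qed
  finally obtain I J where I: "\<And>n. (?f n has_integral I n) (cbox 0 T)" and J: "(?g has_integral J) (cbox 0 T)"
    and IJ: "I \<longlonglongrightarrow> J"
    by (rule uniform_limit_integral_cbox) (auto intro!: continuous_intros)
  have "(?f n has_integral (\<Sum>j<n. b j * (if q j - q l = 0 then of_real T else 0))) {0..T}" for n
    unfolding T_def by (intro has_integral_sum has_integral_mult_right integral_cis_int) auto
  note has_integral_unique[OF I[unfolded cbox_interval] this]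
  moreover have "b j * (if q j - q l = 0 then of_real T else 0) = (if j = l then of_real T * b l else 0)" for j
    by (simp add: inj_eq[OF inj])
  ultimately have "I n = (\<Sum>j<n. if j = l then of_real T * b l else 0)" for n
    by simp
  then have "I n = of_real T * b l" if "n > l" for n
    using that by (simp only: sum.delta finite_lessThan) simp
  then have "I \<longlonglongrightarrow> of_real T * b l"
    by (intro tendsto_eventually) (auto simp: eventually_sequentially intro!: exI[of _ "Suc l"])
  with IJ have "J = of_real T * b l" by (rule LIMSEQ_unique)
  with J show ?thesis by (simp add: fcoeff_def T_def integral_unique)
qed

text \<open>Consecutive values give \<open>\<omega> r(m + 1) = r(m)\<close> at all naturals, hence
  as polynomials. A shift of the argument preserves the leading coefficient, so
  \<open>\<omega> \<noteq> 1\<close> forces it to vanish.\<close>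

lemma poly_geometric_eq_0:
  fixes r :: "complex poly"
  assumes "\<omega> \<noteq> 1" "\<omega> \<noteq> 0" and r: "\<And>m::nat. \<omega> ^ m * poly r (of_nat m) = c"
  shows "r = 0"
proof -
  have "poly (Polynomial.smult \<omega> (pcompose r [:1, 1:]) - r) (of_nat m) = 0" for m
  proof -
    have "\<omega> ^ m * (\<omega> * poly r (of_nat m + 1)) = \<omega> ^ m * poly r (of_nat m)"
      using r[of m] r[of "Suc m"] by (simp add: algebra_simps)
    with \<open>\<omega> \<noteq> 0\<close> have "\<omega> * poly r (of_nat m + 1) = poly r (of_nat m)"
      by (subst (asm) mult_cancel_left) simp
    then show ?thesis by (simp add: poly_pcompose ac_simps)
  qed
  then have "range (of_nat :: nat \<Rightarrow> complex) \<subseteq> {x. poly (Polynomial.smult \<omega> (pcompose r [:1, 1:]) - r) x = 0}"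
    by auto
  moreover have "infinite (range (of_nat :: nat \<Rightarrow> complex))"
    by (rule range_inj_infinite) (rule inj_of_nat)
  ultimately have "Polynomial.smult \<omega> (pcompose r [:1, 1:]) - r = 0"
    using poly_roots_finite finite_subset by blast
  then have "Polynomial.smult \<omega> (pcompose r [:1, 1:]) = r" by simp
  then have "Polynomial.lead_coeff (Polynomial.smult \<omega> (pcompose r [:1, 1:])) = Polynomial.lead_coeff r" by simp
  then have "\<omega> * Polynomial.lead_coeff r = Polynomial.lead_coeff r"
    by (subst (asm) lead_coeff_smult) (simp add: lead_coeff_comp)
  with assms show ?thesis by simp
qed

section \<open>A Liouville number\<close>

text \<open>Take \<open>\<alpha>\<close> as the sum of \<open>2^(-n!)\<close> and
  \<open>p n / q n\<close> as its partial sum up to the index \<open>n + 1\<close>. The tail is at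
  most \<open>2 * 2^(-(n+2)!)\<close>; multiplied by \<open>q n = 2^((n+1)!)\<close> it is still at
  most \<open>2 * (q n)^(-(n+1))\<close>, which beats every fixed power of
  \<open>q n\<close>.\<close>

lemma liouville_approximation:
  obtains \<alpha> :: real and p q :: "nat \<Rightarrow> int"
  where "inj q" "filterlim q at_top sequentially" "\<And>n. of_int (p n) - \<alpha> * of_int (q n) \<noteq> 0"
    "\<And>r. summable (\<lambda>n. \<bar>of_int (p n) - \<alpha> * of_int (q n)\<bar> * (1 + \<bar>of_int (p n)\<bar> + \<bar>of_int (q n)\<bar>) ^ r)"
proof -
  define a :: "nat \<Rightarrow> real" where "a n = (1 / 2) ^ fact n" for n
  have half: "summable (\<lambda>n. (1 / 2 :: real) ^ n)"
    by (rule summable_geometric) simp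
  have a_pos: "a n > 0" for n by (simp add: a_def)
  have a_le: "a n \<le> (1 / 2) ^ n" for n
    unfolding a_def by (rule power_decreasing) (auto intro: fact_ge_self)
  have a: "summable a"
    by (rule summable_comparison_test'[OF half, of 0]) (use a_le a_pos in \<open>auto simp: less_imp_le\<close>)
  define \<alpha> where "\<alpha> = suminf a"
  \<comment> \<open>Starting at \<open>1!\<close> makes \<open>q\<close> strictly increasing, since
    \<open>0!\<close> and \<open>1!\<close> coincide.\<close>
  define q :: "nat \<Rightarrow> int" where "q n = 2 ^ fact (Suc n)" for n
  define p :: "nat \<Rightarrow> int" where "p n = (\<Sum>i<Suc (Suc n). 2 ^ (fact (Suc n) - fact i))" for n
  define tail where "tail n = suminf (\<lambda>i. a (i + Suc (Suc n)))" for n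
  have q_ge: "real_of_int (q n) \<ge> 1" for n
    by (simp add: q_def)
  have p: "real_of_int (p n) = of_int (q n) * (\<Sum>i<Suc (Suc n). a i)" for n
  proof -
    have "(2::real) ^ (fact (Suc n) - fact i) = 2 ^ fact (Suc n) * a i" if "i < Suc (Suc n)" for i
    proof -
      have "(fact i :: nat) \<le> fact (Suc n)"
        using that by (intro fact_mono) auto
      then show ?thesis
        by (simp add: a_def power_diff power_one_over field_simps del: fact_Suc)
    qed
    then show ?thesis
      by (simp add: p_def q_def sum_distrib_left del: fact_Suc sum.lessThan_Suc)
  qed
  have diff: "of_int (p n) - \<alpha> * of_int (q n) = - of_int (q n) * tail n" for n
    unfolding p \<alpha>_def tail_def suminf_split_initial_segment[OF a, of "Suc (Suc n)"]
    by (simp add: algebra_simps)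
  have tail_sum: "summable (\<lambda>i. a (i + Suc (Suc n)))" for n
    using a by (simp add: summable_iff_shift del: add_Suc_right)
  have tail_pos: "tail n > 0" for n
    unfolding tail_def using tail_sum a_pos by (rule suminf_pos)
  \<comment> \<open>Factorials grow by at least 1 at each step from \<open>m \<ge> 1\<close> on, so
    a geometric series with ratio 1/2 dominates the tail.\<close>
  have fact_add: "fact (i + m) \<ge> (fact m + i :: nat)" if "m \<ge> 1" for i m
  proof (induction i)
    case (Suc i)
    have "(fact (i + m) :: nat) \<ge> 1" by (rule fact_ge_1)
    then have "fact m + Suc i \<le> 2 * (fact (i + m) :: nat)" using Suc by linarith
    also have "\<dots> \<le> Suc (i + m) * fact (i + m)"
      using that by (intro mult_right_mono) auto
    finally show ?case by simp
  qed simp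
  have tail_le: "tail n \<le> 2 * (1 / 2) ^ fact (Suc (Suc n))" for n
  proof -
    have "tail n \<le> suminf (\<lambda>i. (1 / 2) ^ fact (Suc (Suc n)) * (1 / 2) ^ i)"
      unfolding tail_def
    proof (rule suminf_le[OF _ tail_sum summable_mult[OF half]])
      show "a (i + Suc (Suc n)) \<le> (1 / 2) ^ fact (Suc (Suc n)) * (1 / 2) ^ i" for i
        unfolding a_def power_add[symmetric] by (rule power_decreasing[OF fact_add]) auto
    qed
    also have "\<dots> = (1 / 2) ^ fact (Suc (Suc n)) * 2"
      using suminf_mult[OF half] suminf_geometric[of "1 / 2 :: real"] by simp
    finally show ?thesis by simp
  qed
  have \<alpha>_le: "\<alpha> \<le> 2"
    using suminf_le[OF a_le a half] suminf_geometric[of "1 / 2 :: real"] by (simp add: \<alpha>_def)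
  \<comment> \<open>Since \<open>0 \<le> p n \<le> 2 q n\<close>, the weight in the summability
    claim is controlled by a power of \<open>q n\<close> alone.\<close>
  have size: "1 + \<bar>of_int (p n)\<bar> + \<bar>of_int (q n)\<bar> \<le> 4 * real_of_int (q n)" for n
  proof -
    have "real_of_int (p n) = \<alpha> * of_int (q n) - of_int (q n) * tail n"
      using diff[of n] by simp
    moreover have "of_int (q n) * tail n \<ge> 0"
      using q_ge[of n] tail_pos[of n] by simp
    moreover have "\<alpha> * of_int (q n) \<le> 2 * of_int (q n)"
      using q_ge[of n] \<alpha>_le by (intro mult_right_mono) auto
    moreover have "real_of_int (p n) \<ge> 0"
      unfolding p using q_ge[of n] a_pos by (intro mult_nonneg_nonneg sum_nonneg) (auto simp: less_imp_le)
    ultimately show ?thesis using q_ge[of n] by linarith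
  qed
  show ?thesis
  proof
    have mono: "fact (Suc m) < (fact (Suc n) :: nat)" if "m < n" for m n
      using that by (intro fact_less_mono) auto
    have "strict_mono q"
      unfolding q_def by (intro strict_monoI power_strict_increasing mono) auto
    then show "inj q" by (rule strict_mono_imp_inj_on)
    have "int n \<le> q n" for n
    proof -
      have "n < 2 ^ n" by (rule less_exp)
      also have "(2 :: nat) ^ n \<le> 2 ^ fact (Suc n)"
        using fact_ge_self[of "Suc n"] by (intro power_increasing) linarith+
      finally have "int n < int (2 ^ fact (Suc n))" by linarith
      then show ?thesis by (simp add: q_def del: fact_Suc)
    qed
    then show "filterlim q at_top sequentially"
      by (intro filterlim_at_top_mono[OF filterlim_int_sequentially]) (auto intro: always_eventually)
    show "of_int (p n) - \<alpha> * of_int (q n) \<noteq> 0" for n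
      using diff[of n] q_ge[of n] tail_pos[of n] by auto
    fix r
    show "summable (\<lambda>n. \<bar>of_int (p n) - \<alpha> * of_int (q n)\<bar> * (1 + \<bar>of_int (p n)\<bar> + \<bar>of_int (q n)\<bar>) ^ r)"
    \<comment> \<open>The comparison starts at \<open>n = r\<close>: from there
      \<open>r * Q + n \<le> Suc n * Q\<close>, which leaves a factor
      \<open>(1 / 2) ^ n\<close>.\<close>
    proof (rule summable_comparison_test'[OF summable_mult[OF half], of r _ "2 * 4 ^ r"])
      fix n assume n: "n \<ge> r"
      define Q :: nat where "Q = fact (Suc n)"
      have Q: "n \<le> Q" "fact (Suc (Suc n)) = Q + Suc n * Q"
        using fact_ge_self[of "Suc n"] by (auto simp: Q_def simp del: fact_Suc) (simp add: algebra_simps)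
      have q: "real_of_int (q n) = 2 ^ Q" by (simp add: q_def Q_def)
      have "\<bar>of_int (p n) - \<alpha> * of_int (q n)\<bar> = 2 ^ Q * tail n"
        unfolding diff using tail_pos[of n] by (simp add: q abs_mult)
      also have "\<dots> \<le> 2 ^ Q * (2 * (1 / 2) ^ (Q + Suc n * Q))"
        using tail_le[of n] Q by (intro mult_left_mono) auto
      also have "\<dots> = 2 * (1 / 2) ^ (Suc n * Q)"
        by (simp add: power_add power_one_over)
      finally have "\<bar>of_int (p n) - \<alpha> * of_int (q n)\<bar> * (1 + \<bar>of_int (p n)\<bar> + \<bar>of_int (q n)\<bar>) ^ r
          \<le> 2 * (1 / 2) ^ (Suc n * Q) * (4 * 2 ^ Q) ^ r"
        using size[of n] by (intro mult_mono power_mono) (auto simp: q)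
      also have "\<dots> = 2 * 4 ^ r * (2 ^ (r * Q) / 2 ^ (Suc n * Q))"
        by (simp add: power_mult_distrib power_mult[symmetric] power_one_over mult.commute[of Q r])
      also have "(2::real) ^ (r * Q) / 2 ^ (Suc n * Q) \<le> (1 / 2) ^ n"
      proof -
        have "r * Q + n \<le> Suc n * Q"
          using add_mono[OF mult_le_mono1[OF n, of Q] Q(1)] by simp
        then have "(2::real) ^ (r * Q + n) \<le> 2 ^ (Suc n * Q)"
          by (intro power_increasing) auto
        then show ?thesis by (simp add: power_add power_one_over field_simps)
      qed
      finally show "norm (\<bar>of_int (p n) - \<alpha> * of_int (q n)\<bar> * (1 + \<bar>of_int (p n)\<bar> + \<bar>of_int (q n)\<bar>) ^ r)
          \<le> 2 * 4 ^ r * (1 / 2) ^ n"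
        by simp
    qed
  qed
qed

section \<open>Exponential series and polynomials with periodic coefficients\<close>

definition exp_series :: "(nat \<Rightarrow> complex) \<Rightarrow> (nat \<Rightarrow> 'a::real_inner) \<Rightarrow> 'a \<Rightarrow> complex" where
  "exp_series c k x = suminf (\<lambda>n. c n * cis (k n \<bullet> x))"

text \<open>Decay is measured against the size of the frequency \<open>k n\<close> and not against
  \<open>n\<close>, because each derivative costs one factor of that size.\<close>

definition rapidly_decreasing :: "(nat \<Rightarrow> complex) \<Rightarrow> (nat \<Rightarrow> 'a::real_normed_vector) \<Rightarrow> bool" where
  "rapidly_decreasing c k \<longleftrightarrow> (\<forall>r. summable (\<lambda>n. norm (c n) * (1 + norm (k n)) ^ r))"

lemma exp_series_has_derivative:
  assumes "rapidly_decreasing c k"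
  shows "(exp_series c k has_derivative
    (\<lambda>h. suminf (\<lambda>n. c n * (\<i> * of_real (k n \<bullet> h)) * cis (k n \<bullet> x)))) (at x)"
  unfolding exp_series_def
proof (rule has_derivative_suminf)
  show "((\<lambda>x. c n * cis (k n \<bullet> x)) has_derivative
      (\<lambda>h. c n * (\<i> * of_real (k n \<bullet> h)) * cis (k n \<bullet> x))) (at x)" for n x
  proof -
    have "((\<lambda>x. \<i> * of_real (k n \<bullet> x)) has_derivative (\<lambda>h. \<i> * of_real (k n \<bullet> h))) (at x)"
      by (intro bounded_linear_imp_has_derivative bounded_linear_compose[OF bounded_linear_mult_right]
          bounded_linear_compose[OF bounded_linear_of_real] bounded_linear_inner_right)
    from has_derivative_mult_right[OF has_derivative_compose[OF this DERIV_exp[unfolded has_field_derivative_def]], of "c n"]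
    show ?thesis by (simp add: cis_conv_exp ac_simps)
  qed
  show "summable (\<lambda>n. norm (c n) * (1 + norm (k n)) ^ 1)"
    using assms unfolding rapidly_decreasing_def by blast
  show "norm (c n * (\<i> * of_real (k n \<bullet> h)) * cis (k n \<bullet> x)) \<le> norm (c n) * (1 + norm (k n)) ^ 1 * norm h"
    for n x h
  proof -
    have "\<bar>k n \<bullet> h\<bar> \<le> (1 + norm (k n)) * norm h"
      using Cauchy_Schwarz_ineq2[of "k n" h] by (simp add: distrib_right add_increasing)
    then show ?thesis by (simp add: norm_mult mult_left_mono mult.assoc)
  qed
  have "summable (\<lambda>n. norm (c n) * (1 + norm (k n)) ^ 0)"
    using assms unfolding rapidly_decreasing_def by blast
  then show "summable (\<lambda>n. c n * cis (k n \<bullet> 0))"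
    by (simp add: summable_norm_cancel)
qed

lemma exp_series_partial_deriv:
  fixes k :: "nat \<Rightarrow> real ^ 'n::finite"
  assumes "rapidly_decreasing c k"
  shows "partial_deriv j (exp_series c k) = exp_series (\<lambda>n. c n * (\<i> * of_real (k n $ j))) k"
  using partial_deriv_has_derivative[OF exp_series_has_derivative[OF assms], of j]
  by (auto simp: exp_series_def inner_axis)

lemma rapidly_decreasing_deriv:
  fixes k :: "nat \<Rightarrow> real ^ 'n::finite"
  assumes "rapidly_decreasing c k"
  shows "rapidly_decreasing (\<lambda>n. c n * (\<i> * of_real (k n $ j))) k"
  unfolding rapidly_decreasing_def
proof
  fix r
  have "summable (\<lambda>n. norm (c n) * (1 + norm (k n)) ^ Suc r)"
    using assms unfolding rapidly_decreasing_def by blast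
  then show "summable (\<lambda>n. norm (c n * (\<i> * of_real (k n $ j))) * (1 + norm (k n)) ^ r)"
  proof (rule summable_comparison_test'[where N = 0])
    fix n
    have "\<bar>k n $ j\<bar> \<le> 1 + norm (k n)"
      using component_le_norm_cart[of "k n" j] by linarith
    then have "\<bar>k n $ j\<bar> * (norm (c n) * (1 + norm (k n)) ^ r) \<le> (1 + norm (k n)) * (norm (c n) * (1 + norm (k n)) ^ r)"
      by (rule mult_right_mono) simp
    then show "norm (norm (c n * (\<i> * of_real (k n $ j))) * (1 + norm (k n)) ^ r) \<le> norm (c n) * (1 + norm (k n)) ^ Suc r"
      by (simp add: norm_mult abs_mult ac_simps)
  qed
qed

text \<open>For fixed frequencies the rapidly decreasing series are closed under partial
  derivatives, so \<open>Cinf_coinduct\<close> applies to the whole class.\<close>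

lemma exp_series_Cinf:
  fixes k :: "nat \<Rightarrow> real ^ 'n::finite"
  assumes "rapidly_decreasing c k"
  shows "exp_series c k \<in> Cinf"
proof (rule Cinf_coinduct[of _ "{exp_series c k |c. rapidly_decreasing c k}"])
  fix f and x :: "real ^ 'n"
  assume "f \<in> {exp_series c k |c. rapidly_decreasing c k}"
  then show "f differentiable (at x)"
    using exp_series_has_derivative unfolding differentiable_def by blast
next
  fix f and j :: 'n
  assume "f \<in> {exp_series c k |c. rapidly_decreasing c k}"
  then show "partial_deriv j f \<in> {exp_series c k |c. rapidly_decreasing c k}"
    using exp_series_partial_deriv rapidly_decreasing_deriv by blast
qed (use assms in auto)

section \<open>Restriction of the algebra to a coordinate plane\<close>

definition slice :: "'n \<Rightarrow> 'n \<Rightarrow> real \<Rightarrow> real \<Rightarrow> real ^ 'n::finite" where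
  "slice i j s t = s *\<^sub>R axis i 1 + t *\<^sub>R axis j 1"

text \<open>An element of the algebra, restricted to \<open>slice i j\<close> at the first coordinates that are
  multiples of the period, is a polynomial in both coordinates whose coefficients are periodic
  functions of the second coordinate. The outer variable stands for the first coordinate.\<close>

definition slice_poly :: "'n::finite \<Rightarrow> 'n \<Rightarrow> nat \<Rightarrow> (real \<Rightarrow> complex poly poly) \<Rightarrow> (real ^ 'n \<Rightarrow> complex) \<Rightarrow> bool" where
  "slice_poly i j N P f \<longleftrightarrow> N > 0 \<and> (\<forall>t. P (t + 2 * pi * real N) = P t) \<and>
    (\<exists>d. \<forall>t a b. a > d \<or> b > d \<longrightarrow> Polynomial.coeff (Polynomial.coeff (P t) a) b = 0) \<and>
    (\<forall>a b. continuous_on UNIV (\<lambda>t. Polynomial.coeff (Polynomial.coeff (P t) a) b)) \<and>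
    (\<forall>m t. f (slice i j (2 * pi * real N * real m) t)
      = poly (poly (P t) [:of_real (2 * pi * real N * real m):]) (of_real t))"

text \<open>The sample points for \<open>N * M\<close> are among those for \<open>N\<close>, so the
  same \<open>P\<close> serves. This brings two elements to a common period.\<close>

lemma slice_poly_period:
  assumes "slice_poly i j N P f" "M > 0"
  shows "slice_poly i j (N * M) P f"
proof -
  have per: "P (t + 2 * pi * real N) = P t" for t
    using assms by (auto simp: slice_poly_def)
  have "P (t + real n * (2 * pi * real N)) = P t" for n t
  proof (induction n)
    case (Suc n)
    then show ?case using per[of "t + real n * (2 * pi * real N)"] by (simp add: algebra_simps)
  qed simp
  from this[of _ M] have "P (t + 2 * pi * real (N * M)) = P t" for t
    by (simp add: ac_simps)
  moreover have "f (slice i j (2 * pi * real (N * M) * real m) t)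
      = poly (poly (P t) [:of_real (2 * pi * real (N * M) * real m):]) (of_real t)" for m t
  proof -
    have "f (slice i j (2 * pi * real N * real (M * m)) t)
        = poly (poly (P t) [:of_real (2 * pi * real N * real (M * m)):]) (of_real t)"
      using assms unfolding slice_poly_def by blast
    then show ?thesis by (simp only: of_nat_mult mult.assoc)
  qed
  ultimately show ?thesis
    using assms by (simp add: slice_poly_def)
qed

lemma slice_poly_add:
  assumes "slice_poly i j N P f" "slice_poly i j N Q g"
  shows "slice_poly i j N (\<lambda>t. P t + Q t) (\<lambda>x. f x + g x)"
proof -
  obtain d e where "\<And>t a b. a > d \<or> b > d \<Longrightarrow> Polynomial.coeff (Polynomial.coeff (P t) a) b = 0"
    "\<And>t a b. a > e \<or> b > e \<Longrightarrow> Polynomial.coeff (Polynomial.coeff (Q t) a) b = 0"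
    using assms unfolding slice_poly_def by blast
  then have "\<exists>d. \<forall>t a b. a > d \<or> b > d \<longrightarrow> Polynomial.coeff (Polynomial.coeff (P t + Q t) a) b = 0"
    by (intro exI[of _ "max d e"]) auto
  moreover have "continuous_on UNIV (\<lambda>t. Polynomial.coeff (Polynomial.coeff (P t + Q t) a) b)" for a b
    using assms by (auto simp: slice_poly_def intro!: continuous_intros)
  ultimately show ?thesis
    using assms unfolding slice_poly_def by simp
qed

lemma coeff_coeff_mult:
  "Polynomial.coeff (Polynomial.coeff (p * q) a) b
    = (\<Sum>k\<le>a. \<Sum>l\<le>b. Polynomial.coeff (Polynomial.coeff p k) l * Polynomial.coeff (Polynomial.coeff q (a - k)) (b - l))"
  by (simp add: coeff_mult coeff_sum)

lemma slice_poly_mult: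
  assumes "slice_poly i j N P f" "slice_poly i j N Q g"
  shows "slice_poly i j N (\<lambda>t. P t * Q t) (\<lambda>x. f x * g x)"
proof -
  obtain d e where d: "\<And>t a b. a > d \<or> b > d \<Longrightarrow> Polynomial.coeff (Polynomial.coeff (P t) a) b = 0"
    and e: "\<And>t a b. a > e \<or> b > e \<Longrightarrow> Polynomial.coeff (Polynomial.coeff (Q t) a) b = 0"
    using assms unfolding slice_poly_def by blast
  have "Polynomial.coeff (Polynomial.coeff (P t * Q t) a) b = 0" if "a > d + e \<or> b > d + e" for t a b
    unfolding coeff_coeff_mult
  proof (intro sum.neutral ballI)
    fix k l
    have "k > d \<or> l > d \<or> a - k > e \<or> b - l > e" using that by linarith
    then show "Polynomial.coeff (Polynomial.coeff (P t) k) l * Polynomial.coeff (Polynomial.coeff (Q t) (a - k)) (b - l) = 0"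
      using d[of k l t] e[of "a - k" "b - l" t] by auto
  qed
  moreover have "continuous_on UNIV (\<lambda>t. Polynomial.coeff (Polynomial.coeff (P t * Q t) a) b)" for a b
    unfolding coeff_coeff_mult using assms by (intro continuous_intros) (auto simp: slice_poly_def)
  ultimately show ?thesis
    using assms unfolding slice_poly_def by (intro conjI allI exI[of _ "d + e"]) auto
qed

text \<open>At first coordinates that are multiples of the period, \<open>f\<close> takes its values
  at first coordinate 0; these form a polynomial constant in both variables.\<close>

lemma slice_poly_periodic:
  assumes f: "f \<in> Cinf" "periodic N f" and N: "N > 0" and ij: "i \<noteq> j"
  shows "slice_poly i j N (\<lambda>t. [:[:f (slice i j 0 t):]:]) f"
proof -
  have per: "f (slice i j (s + 2 * pi * real N * of_int k) (t + 2 * pi * real N * of_int l)) = f (slice i j s t)" for s t k l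
  proof -
    let ?k = "\<chi> n. if n = i then k else if n = j then l else 0"
    have "f (slice i j s t + (\<chi> n. 2 * pi * real N * of_int (?k $ n))) = f (slice i j s t)"
      using f(2) unfolding periodic_def by blast
    moreover have "slice i j s t + (\<chi> n. 2 * pi * real N * of_int (?k $ n))
        = slice i j (s + 2 * pi * real N * of_int k) (t + 2 * pi * real N * of_int l)"
      using ij by (simp add: vec_eq_iff slice_def axis_def)
    ultimately show ?thesis by simp
  qed
  have "continuous_on UNIV (\<lambda>t. f (slice i j 0 t))"
    unfolding slice_def
    by (rule continuous_on_compose2[OF Cinf_continuous[OF f(1), of UNIV]]) (auto intro!: continuous_intros)
  then have "continuous_on UNIV (\<lambda>t. Polynomial.coeff (Polynomial.coeff [:[:f (slice i j 0 t):]:] a) b)" for a b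
    by (cases a; cases b) simp_all
  then show ?thesis
    using N per[of 0 0 _ 1] per[of 0 "int m" t 0 for m t]
    by (auto simp: slice_poly_def coeff_pCons split: nat.splits intro!: exI[of _ 0])
qed

text \<open>On the slice the \<open>i\<close>-th coordinate is the outer variable, the
  \<open>j\<close>-th the inner one, and all others vanish.\<close>

lemma slice_poly_coord:
  assumes ij: "i \<noteq> j"
  shows "\<exists>P. slice_poly i j 1 P (\<lambda>x. of_real (x $ k))"
proof -
  have "slice_poly i j 1 (\<lambda>_. [:0, 1:]) (\<lambda>x. of_real (x $ i))"
    using ij by (auto simp: slice_poly_def slice_def axis_def coeff_pCons split: nat.splits intro!: exI[of _ 1])
  moreover have "slice_poly i j 1 (\<lambda>_. [:[:0, 1:]:]) (\<lambda>x. of_real (x $ j))"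
    using ij by (auto simp: slice_poly_def slice_def axis_def coeff_pCons split: nat.splits intro!: exI[of _ 1])
  moreover have "slice_poly i j 1 (\<lambda>_. 0) (\<lambda>x. of_real (x $ k))" if "k \<noteq> i" "k \<noteq> j"
    using that by (auto simp: slice_poly_def slice_def axis_def)
  ultimately show ?thesis by blast
qed

text \<open>Functions with a slice polynomial form a subalgebra once two of them are brought to the
  period \<open>N * M\<close>. It contains the generators, so minimality of the hull
  applies.\<close>

lemma slice_poly_adjoin_coords:
  assumes ij: "i \<noteq> j" and f: "f \<in> adjoin_coords (Cinf_PT :: (real ^ 'n::finite \<Rightarrow> complex) set)"
  shows "\<exists>N P. slice_poly i j N P f"
proof -
  let ?S = "{f \<in> Cinf. \<exists>N P. slice_poly i j N P f}"
  have periodic: "f \<in> ?S" if "f \<in> Cinf" "periodic N f" "N > 0" for f N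
    using slice_poly_periodic[OF that ij] that by blast
  have "subalgebra_Cinf ?S"
    unfolding subalgebra_Cinf_def
  proof (intro conjI allI ballI)
    show "(\<lambda>_. c) \<in> ?S" for c
      by (rule periodic[of _ 1]) (auto simp: Cinf_const periodic_def)
    fix f g assume "f \<in> ?S" "g \<in> ?S"
    then obtain N P M Q where fg: "f \<in> Cinf" "g \<in> Cinf" and NP: "slice_poly i j N P f" and MQ: "slice_poly i j M Q g"
      by blast
    then have "N > 0" "M > 0" by (auto simp: slice_poly_def)
    then have P: "slice_poly i j (N * M) P f" and Q: "slice_poly i j (N * M) Q g"
      using slice_poly_period[OF NP] slice_poly_period[OF MQ, of N] by (simp_all add: mult.commute)
    show "(\<lambda>x. f x + g x) \<in> ?S" "(\<lambda>x. f x * g x) \<in> ?S"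
      using Cinf_add[OF fg] Cinf_mult[OF fg] slice_poly_add[OF P Q] slice_poly_mult[OF P Q] by blast+
  qed auto
  moreover have "Cinf_PT \<union> range (\<lambda>j x. complex_of_real (x $ j)) \<subseteq> ?S"
    using periodic slice_poly_coord[OF ij] Cinf_coord by (fastforce simp: Cinf_PT_def)
  ultimately have "adjoin_coords Cinf_PT \<subseteq> ?S"
    unfolding adjoin_coords_def by (intro hull_minimal)
  with f show ?thesis by blast
qed

section \<open>Small divisors\<close>

lemma norm_cis_minus_1_le: "norm (cis x - 1) \<le> \<bar>x\<bar>"
  using dist_exp_i_1[of x] abs_sin_x_le_abs_x[of "x / 2"] by (simp add: cis_conv_exp)

lemma cis_neq_1:
  assumes "x \<noteq> 0" "\<bar>x\<bar> < 2 * pi"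
  shows "cis x \<noteq> 1"
proof
  assume "cis x = 1"
  then have "cos x = 1" by (metis cis.sel(1) one_complex.sel(1))
  then obtain n :: int where n: "x = of_int n * 2 * pi"
    using cos_one_2pi_int by blast
  have "n \<noteq> 0" using n assms by auto
  then have "\<bar>of_int n :: real\<bar> \<ge> 1" by linarith
  with n assms(2) show False by (auto simp: abs_mult)
qed

lemma fcoeff_add:
  assumes "continuous_on UNIV f" "continuous_on UNIV g"
  shows "fcoeff N q (\<lambda>t. f t + g t) = fcoeff N q f + fcoeff N q g"
  unfolding fcoeff_def
  using integral_add[OF fcoeff_integrable[OF assms(1)] fcoeff_integrable[OF assms(2)], of _ "- q" "- q"]
  by (simp only: distrib_right)

lemma fcoeff_cmult: "fcoeff N q (\<lambda>t. f t * c) = fcoeff N q f * c"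
  unfolding fcoeff_def
  by (subst integral_mult_left[symmetric]) (simp add: ac_simps)

lemma fcoeff_sum:
  assumes "finite A" "\<And>a. a \<in> A \<Longrightarrow> continuous_on UNIV (f a)"
  shows "fcoeff N q (\<lambda>t. \<Sum>a\<in>A. f a t) = (\<Sum>a\<in>A. fcoeff N q (f a))"
  using assms
proof (induction A rule: finite_induct)
  case empty
  then show ?case by (simp add: fcoeff_def)
next
  case (insert a A)
  then show ?case
    using fcoeff_add[of "f a" "\<lambda>t. \<Sum>a\<in>A. f a t" N q] by (simp add: continuous_on_sum)
qed

lemma poly_eq_sum_atMost:
  fixes p :: "'a::comm_semiring_1 poly"
  assumes "\<And>a. a > d \<Longrightarrow> Polynomial.coeff p a = 0"
  shows "poly p x = (\<Sum>a\<le>d. Polynomial.coeff p a * x ^ a)"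
proof -
  have "Polynomial.degree p \<le> d"
    using assms by (intro degree_le) auto
  then show ?thesis
    unfolding poly_altdef by (intro sum.mono_neutral_left) (auto simp: coeff_eq_0)
qed

text \<open>For a family \<open>P t\<close> the degrees may vary with \<open>t\<close>; a fixed
  summation range lets Fourier coefficients in \<open>t\<close> be taken term by term.\<close>

lemma poly_poly_eq_sum:
  fixes p :: "'a::comm_semiring_1 poly poly"
  assumes d: "\<And>a b. a > d \<or> b > d \<Longrightarrow> Polynomial.coeff (Polynomial.coeff p a) b = 0"
  shows "poly (poly p [:x:]) y = (\<Sum>a\<le>d. \<Sum>b\<le>d. Polynomial.coeff (Polynomial.coeff p a) b * (y ^ b * x ^ a))"
proof -
  have "poly p [:x:] = (\<Sum>a\<le>d. Polynomial.coeff p a * [:x:] ^ a)"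
    by (rule poly_eq_sum_atMost) (auto intro!: poly_eqI d)
  then have "poly (poly p [:x:]) y = (\<Sum>a\<le>d. poly (Polynomial.coeff p a) y * x ^ a)"
    by (simp add: poly_sum)
  also have "\<dots> = (\<Sum>a\<le>d. (\<Sum>b\<le>d. Polynomial.coeff (Polynomial.coeff p a) b * y ^ b) * x ^ a)"
    by (intro sum.cong refl, subst poly_eq_sum_atMost[where d = d]) (auto intro!: d)
  finally show ?thesis
    by (simp add: sum_distrib_right mult.assoc)
qed

lemma slice_inner: "i \<noteq> j \<Longrightarrow> slice i j a b \<bullet> slice i j s t = a * s + b * t"
  by (simp add: slice_def inner_add_left inner_add_right inner_axis_axis)

text \<open>The characteristics of \<open>D i - \<alpha> D j\<close> are the lines with direction \<open>(1, -\<alpha>)\<close>. Along them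
  the equation integrates termwise, producing the numbers \<open>p n - \<alpha> q n\<close> as frequencies
  and no longer as coefficients.\<close>

lemma transport_along_characteristic:
  fixes f :: "real ^ 'n::finite \<Rightarrow> complex" and p q :: "nat \<Rightarrow> int" and \<alpha> :: real
  defines "\<mu> \<equiv> \<lambda>n. of_int (p n) - \<alpha> * of_int (q n)"
  assumes f: "f \<in> Cinf" and ij: "i \<noteq> j"
    and summable: "summable (\<lambda>n. \<bar>\<mu> n\<bar>)"
    and eq: "\<And>x. D i f x - of_real \<alpha> * D j f x
      = exp_series (\<lambda>n. of_real (\<mu> n)) (\<lambda>n. slice i j (of_int (p n)) (of_int (q n))) x"
  shows "f (slice i j s (t - \<alpha> * s))
    = f (slice i j 0 t) + suminf (\<lambda>n. (cis (\<mu> n * s) - 1) * cis (of_int (q n) * t))"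
proof -
  let ?F = "\<lambda>s. f (slice i j s (t - \<alpha> * s))"
  let ?R = "\<lambda>s. suminf (\<lambda>n. (cis (\<mu> n * s) - 1) * cis (of_int (q n) * t))"
  let ?r = "\<lambda>s. suminf (\<lambda>n. of_real (\<mu> n) * cis (\<mu> n * s + of_int (q n) * t))"
  have sum_r: "summable (\<lambda>n. of_real (\<mu> n) * cis (\<mu> n * s + of_int (q n) * t))" for s
    by (rule summable_norm_cancel) (use summable in \<open>simp add: norm_mult\<close>)
  have F: "(?F has_derivative (\<lambda>h. of_real h * (\<i> * ?r s))) (at s)" for s
  proof -
    let ?x = "slice i j s (t - \<alpha> * s)"
    obtain f' where f': "(f has_derivative f') (at ?x)"
      using Cinf_differentiable[OF f] by (auto simp: differentiable_def)
    interpret f': linear f' by (rule has_derivative_linear[OF f'])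
    have "((\<lambda>s. slice i j s (t - \<alpha> * s)) has_derivative (\<lambda>h. h *\<^sub>R (axis i 1 - \<alpha> *\<^sub>R axis j 1))) (at s)"
      unfolding slice_def by (auto intro!: derivative_eq_intros simp: algebra_simps)
    from has_derivative_compose[OF this f']
    have "(?F has_derivative (\<lambda>h. f' (h *\<^sub>R (axis i 1 - \<alpha> *\<^sub>R axis j 1)))) (at s)" .
    also have "(\<lambda>h. f' (h *\<^sub>R (axis i 1 - \<alpha> *\<^sub>R axis j 1)))
        = (\<lambda>h. of_real h * (partial_deriv i f ?x - of_real \<alpha> * partial_deriv j f ?x))"
      by (simp only: f'.scale f'.diff partial_deriv_has_derivative[OF f']) (simp add: scaleR_conv_of_real)
    also have "partial_deriv i f ?x - of_real \<alpha> * partial_deriv j f ?x = \<i> * (D i f ?x - of_real \<alpha> * D j f ?x)"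
      by (simp add: D_def algebra_simps)
    \<comment> \<open>On the characteristic the phase
      \<open>p n * s + q n * (t - \<alpha> * s)\<close> equals
      \<open>\<mu> n * s + q n * t\<close>.\<close>
    also have "D i f ?x - of_real \<alpha> * D j f ?x = ?r s"
      unfolding eq exp_series_def slice_inner[OF ij] by (simp add: \<mu>_def algebra_simps)
    finally show ?thesis .
  qed
  have R: "(?R has_derivative (\<lambda>h. of_real h * (\<i> * ?r s))) (at s)" for s
  proof -
    have "(?R has_derivative (\<lambda>h. suminf (\<lambda>n. of_real h * (\<i> * (of_real (\<mu> n) * cis (\<mu> n * s + of_int (q n) * t)))))) (at s)"
    proof (rule has_derivative_suminf[OF _ _ summable])
      fix n s
      have "((\<lambda>s. \<i> * of_real (\<mu> n * s)) has_derivative (\<lambda>h. \<i> * of_real (\<mu> n * h))) (at s)"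
        by (intro bounded_linear_imp_has_derivative bounded_linear_compose[OF bounded_linear_mult_right]
            bounded_linear_compose[OF bounded_linear_of_real] bounded_linear_mult_right)
      from has_derivative_compose[OF this DERIV_exp[unfolded has_field_derivative_def]]
      have "((\<lambda>s. cis (\<mu> n * s)) has_derivative (\<lambda>h. cis (\<mu> n * s) * (\<i> * of_real (\<mu> n * h)))) (at s)"
        by (simp add: cis_conv_exp)
      from has_derivative_mult_left[OF has_derivative_diff[OF this has_derivative_const[of 1]], of "cis (of_int (q n) * t)"]
      show "((\<lambda>s. (cis (\<mu> n * s) - 1) * cis (of_int (q n) * t)) has_derivative
          (\<lambda>h. of_real h * (\<i> * (of_real (\<mu> n) * cis (\<mu> n * s + of_int (q n) * t))))) (at s)"
        by (simp add: cis_mult[symmetric] ac_simps)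
    next
      show "summable (\<lambda>n. (cis (\<mu> n * 0) - 1) * cis (of_int (q n) * t))" by simp
    qed (simp add: norm_mult)
    also have "(\<lambda>h. suminf (\<lambda>n. of_real h * (\<i> * (of_real (\<mu> n) * cis (\<mu> n * s + of_int (q n) * t)))))
        = (\<lambda>h. of_real h * (\<i> * ?r s))"
      by (simp add: suminf_mult summable_mult sum_r)
    finally show ?thesis .
  qed
  \<comment> \<open>The common derivative makes the difference constant in \<open>s\<close>, and
    \<open>?R 0 = 0\<close> because every factor \<open>cis 0 - 1\<close> vanishes.\<close>
  have "((\<lambda>s. ?F s - ?R s) has_derivative (\<lambda>h. 0)) (at s)" for s
    using has_derivative_diff[OF F R] by simp
  then have "?F s - ?R s = ?F 0 - ?R 0"
    by (intro has_derivative_zero_unique[of UNIV "\<lambda>s. ?F s - ?R s"]) auto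
  then show ?thesis by (simp add: algebra_simps)
qed

text \<open>The contradiction sits in the single continuous periodic function \<open>V 0\<close>:
  its coefficients at \<open>q l\<close> tend to 0, while the transported equation makes them equal
  to \<open>2 pi N\<close> for all large \<open>l\<close>.\<close>

lemma no_slice_poly_solution:
  fixes f :: "real ^ 'n::finite \<Rightarrow> complex" and p q :: "nat \<Rightarrow> int" and \<alpha> :: real
  defines "\<mu> \<equiv> \<lambda>n. of_int (p n) - \<alpha> * of_int (q n)"
  assumes f: "f \<in> Cinf" and ij: "i \<noteq> j"
    and q: "inj q" "filterlim q at_top sequentially" and nz: "\<And>n. \<mu> n \<noteq> 0"
    and summable: "summable (\<lambda>n. \<bar>\<mu> n\<bar>)"
    and eq: "\<And>x. D i f x - of_real \<alpha> * D j f x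
      = exp_series (\<lambda>n. of_real (\<mu> n)) (\<lambda>n. slice i j (of_int (p n)) (of_int (q n))) x"
    and P: "slice_poly i j N P f"
  shows False
proof -
  define T where "T = 2 * pi * real N"
  define \<sigma> where "\<sigma> m = T * real m" for m
  define R where "R m t = suminf (\<lambda>n. (cis (\<mu> n * \<sigma> m) - 1) * cis (of_int (q n) * t))" for m t
  \<comment> \<open>The inner polynomial variable at \<open>t - \<alpha> * \<sigma> m\<close> is
    replaced by its value for \<open>t = 0\<close>, while the periodic coefficients keep
    \<open>t\<close>. What remains is periodic in \<open>t\<close>.\<close>
  define V where "V m t = poly (poly (P t) [:of_real (\<sigma> m):]) (of_real (- \<alpha> * \<sigma> m))" for m t
  have N: "N > 0" and per: "P (t + T) = P t"
    and cont: "continuous_on UNIV (\<lambda>t. Polynomial.coeff (Polynomial.coeff (P t) a) b)"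
    and fP: "f (slice i j (\<sigma> m) t) = poly (poly (P t) [:of_real (\<sigma> m):]) (of_real t)" for t a b m
    using P by (auto simp: slice_poly_def T_def \<sigma>_def)
  obtain d where d: "\<And>t a b. a > d \<or> b > d \<Longrightarrow> Polynomial.coeff (Polynomial.coeff (P t) a) b = 0"
    using P unfolding slice_poly_def by blast
  have T: "T > 0" using N by (simp add: T_def)
  have per_nat: "P (t + T * real l) = P t" for t l
  proof (induction l)
    case (Suc l)
    then show ?case using per[of "t + T * real l"] by (simp add: algebra_simps)
  qed simp
  have R_per: "R m (t + T * real l) = R m t" for m t l
    using cis_int_periodic[of _ t "N * l"] by (simp add: R_def T_def mult.assoc)
  have V_eq: "V m (t - \<alpha> * \<sigma> m) = V 0 t + R m t" for m t
  proof -
    \<comment> \<open>Periodicity of \<open>P\<close> and \<open>R m\<close> makes the transported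
      equation at the points \<open>t + T * l\<close> say that one polynomial \<open>?u\<close>
      vanishes there. Hence \<open>?u = 0\<close>, and it may be evaluated at 0 in place of
      \<open>t\<close>.\<close>
    let ?u = "pcompose (poly (P (t - \<alpha> * \<sigma> m)) [:of_real (\<sigma> m):]) [:of_real (- \<alpha> * \<sigma> m), 1:]
      - poly (P t) [:of_real (\<sigma> 0):] - [:R m t:]"
    have root: "poly ?u (of_real (t + T * real l)) = 0" for l
    proof -
      have "f (slice i j (\<sigma> m) (t + T * real l - \<alpha> * \<sigma> m)) = f (slice i j (\<sigma> 0) (t + T * real l)) + R m (t + T * real l)"
        using transport_along_characteristic[OF f ij summable[unfolded \<mu>_def] eq[unfolded \<mu>_def],
            of "\<sigma> m" "t + T * real l"]
        by (simp add: R_def \<mu>_def \<sigma>_def)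
      moreover have "P (t + T * real l - \<alpha> * \<sigma> m) = P (t - \<alpha> * \<sigma> m)"
        using per_nat[of "t - \<alpha> * \<sigma> m" l] by (simp add: algebra_simps)
      ultimately show ?thesis
        by (simp add: fP per_nat R_per poly_pcompose algebra_simps)
    qed
    have "inj (\<lambda>l. complex_of_real (t + T * real l))"
      using T by (auto simp: inj_on_def)
    then have "infinite (range (\<lambda>l. complex_of_real (t + T * real l)))"
      by (rule range_inj_infinite)
    moreover have "range (\<lambda>l. complex_of_real (t + T * real l)) \<subseteq> {x. poly ?u x = 0}"
      using root by auto
    ultimately have "?u = 0"
      using poly_roots_finite finite_subset by blast
    then have "poly ?u 0 = 0" by simp
    then show ?thesis by (simp add: V_def poly_pcompose \<sigma>_def diff_eq_eq add.commute)
  qed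
  have V_sum: "V m = (\<lambda>t. \<Sum>a\<le>d. \<Sum>b\<le>d. Polynomial.coeff (Polynomial.coeff (P t) a) b
      * (of_real (- \<alpha> * \<sigma> m) ^ b * of_real (\<sigma> m) ^ a))" for m
    unfolding V_def by (intro ext poly_poly_eq_sum d)
  have V_cont: "continuous_on UNIV (V m)" for m
    unfolding V_sum by (intro continuous_intros cont)
  have V_per: "V m (t + 2 * pi * real N) = V m t" for m t
    using per by (simp add: V_def T_def)
  define C where "C l a b = fcoeff N (q l) (\<lambda>t. Polynomial.coeff (Polynomial.coeff (P t) a) b)" for l a b
  \<comment> \<open>Both substituted values are multiples of \<open>m\<close>, so the coefficient of
    \<open>V m\<close> at \<open>q l\<close> is a polynomial in \<open>m\<close>, with
    \<open>a + b\<close> as the exponent of \<open>m\<close>.\<close>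
  define r where "r l = (\<Sum>a\<le>d. \<Sum>b\<le>d. Polynomial.monom (C l a b * (of_real (- \<alpha> * T) ^ b * of_real T ^ a)) (a + b))" for l
  have fcoeff_V: "fcoeff N (q l) (V m) = poly (r l) (of_nat m)" for l m
  proof -
    have "fcoeff N (q l) (V m) = (\<Sum>a\<le>d. \<Sum>b\<le>d. C l a b * (of_real (- \<alpha> * \<sigma> m) ^ b * of_real (\<sigma> m) ^ a))"
      unfolding V_sum C_def
      by (subst fcoeff_sum, simp, intro continuous_intros cont, intro sum.cong refl)
        (subst fcoeff_sum, simp, intro continuous_intros cont, simp only: fcoeff_cmult)
    also have "\<dots> = poly (r l) (of_nat m)"
    proof -
      have "complex_of_real (- \<alpha> * \<sigma> m) = of_real (- \<alpha> * T) * of_nat m"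
        "complex_of_real (\<sigma> m) = of_real T * of_nat m"
        by (simp_all add: \<sigma>_def)
      then show ?thesis
        by (simp only: r_def poly_sum poly_monom power_mult_distrib power_add ac_simps)
    qed
    finally show ?thesis .
  qed
  have R_summable: "summable (\<lambda>n. norm (cis (\<mu> n * \<sigma> m) - 1))" for m
    by (rule summable_comparison_test'[OF summable_mult2[OF summable, of "\<bar>\<sigma> m\<bar>"], of 0])
      (use norm_cis_minus_1_le[of "\<mu> n * \<sigma> m" for n] in \<open>simp add: abs_mult\<close>)
  have R_cont: "continuous_on UNIV (R m)" for m
  proof -
    have "R m = (\<lambda>t. V m (t + (- \<alpha> * \<sigma> m)) - V 0 t)"
      using V_eq[of m] by (auto simp: algebra_simps)
    moreover have "continuous_on UNIV (\<lambda>t. V m (t + (- \<alpha> * \<sigma> m)))"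
      by (rule continuous_on_compose2[OF V_cont]) (auto intro!: continuous_intros)
    ultimately show ?thesis
      using V_cont by (simp add: continuous_on_diff)
  qed
  have r0: "poly (r l) 0 = of_real T" if l: "cis (\<mu> l * T) \<noteq> 1" for l
  proof -
    let ?\<omega> = "cis (\<mu> l * T)"
    \<comment> \<open>Taking coefficients in \<open>V_eq\<close> gives
      \<open>\<omega>^m r(m) = r(0) + T (\<omega>^m - 1)\<close>; moving \<open>T \<omega>^m\<close>
      to the left yields the form required by \<open>poly_geometric_eq_0\<close>.\<close>
    have "?\<omega> ^ m * poly (r l - [:of_real T:]) (of_nat m) = poly (r l) 0 - of_real T" for m
    proof -
      \<comment> \<open>Here \<open>- \<alpha> * q l = \<mu> l - p l\<close>, and
        \<open>p l * \<sigma> m\<close> is an integer multiple of \<open>2 pi\<close>.\<close>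
      have "cis (of_int (q l) * (- \<alpha> * \<sigma> m)) = cis (\<mu> l * \<sigma> m) * cis (of_int (- p l) * (0 + 2 * pi * real (N * m)))"
        by (simp add: cis_mult \<mu>_def \<sigma>_def T_def algebra_simps)
      also have "cis (of_int (- p l) * (0 + 2 * pi * real (N * m))) = 1"
        by (simp only: cis_int_periodic) simp
      finally have \<omega>: "cis (of_int (q l) * (- \<alpha> * \<sigma> m)) = ?\<omega> ^ m"
        by (simp add: Complex.DeMoivre \<sigma>_def ac_simps)
      have "?\<omega> ^ m * poly (r l) (of_nat m) = fcoeff N (q l) (\<lambda>t. V m (t + (- \<alpha> * \<sigma> m)))"
        unfolding fcoeff_shift[OF V_cont V_per N] \<omega> fcoeff_V ..
      also have "(\<lambda>t. V m (t + (- \<alpha> * \<sigma> m))) = (\<lambda>t. V 0 t + R m t)"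
        using V_eq[of m] by (simp add: algebra_simps)
      also have "fcoeff N (q l) \<dots> = fcoeff N (q l) (V 0) + fcoeff N (q l) (R m)"
        using V_cont R_cont by (rule fcoeff_add)
      also have "fcoeff N (q l) (R m) = of_real T * (cis (\<mu> l * \<sigma> m) - 1)"
        unfolding R_def T_def by (rule fcoeff_suminf[OF R_summable q(1), unfolded T_def])
      also have "cis (\<mu> l * \<sigma> m) = ?\<omega> ^ m"
        by (simp add: Complex.DeMoivre \<sigma>_def ac_simps)
      finally show ?thesis
        unfolding fcoeff_V by (simp add: algebra_simps)
    qed
    from poly_geometric_eq_0[OF l _ this] have "r l - [:of_real T:] = 0" by simp
    then show ?thesis by simp
  qed
  have "(\<lambda>l. \<bar>\<mu> l\<bar>) \<longlonglongrightarrow> 0"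
    using summable by (rule summable_LIMSEQ_zero)
  \<comment> \<open>Small but nonzero \<open>\<mu> l\<close> keep the angle
    \<open>\<mu> l * T\<close> strictly between 0 and \<open>2 pi\<close> in absolute value, so
    \<open>\<omega> \<noteq> 1\<close>.\<close>
  then have "\<forall>\<^sub>F l in sequentially. \<bar>\<mu> l\<bar> < 2 * pi / T"
    using T by (intro order_tendstoD(2)) auto
  then have "\<forall>\<^sub>F l in sequentially. fcoeff N (q l) (V 0) = of_real T"
  proof eventually_elim
    case (elim l)
    then have "cis (\<mu> l * T) \<noteq> 1"
      using T nz[of l] by (intro cis_neq_1) (auto simp: abs_mult field_simps)
    then show ?case
      using r0 fcoeff_V[of l 0] by simp
  qed
  then have "(\<lambda>l. fcoeff N (q l) (V 0)) \<longlonglongrightarrow> of_real T"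
    by (rule tendsto_eventually)
  moreover have "(\<lambda>l. fcoeff N (q l) (V 0)) \<longlonglongrightarrow> 0"
    by (rule fcoeff_tendsto_0[OF V_cont V_per N q(2)])
  ultimately show False
    using T LIMSEQ_unique by force
qed

section \<open>An unsolvable equation and its consequences for both modules\<close>

lemma Cinf_T_subset: "Cinf_T \<subseteq> Cinf_PT"
  by (auto simp: Cinf_T_def Cinf_PT_def)

lemma periodic_partial_deriv:
  assumes "periodic N f"
  shows "periodic N (partial_deriv j f)"
  unfolding periodic_def
proof (intro allI)
  fix k :: "int ^ 'a" and x :: "real ^ 'a"
  let ?v = "\<chi> j. 2 * pi * real N * real_of_int (k $ j)"
  have "f (x + ?v + t *\<^sub>R axis j 1) = f (x + t *\<^sub>R axis j 1)" for t
    using assms[unfolded periodic_def, rule_format, of "x + t *\<^sub>R axis j 1" k] by (simp add: ac_simps)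
  then show "partial_deriv j f (x + ?v) = partial_deriv j f x"
    by (simp add: partial_deriv_def)
qed

text \<open>One pair \<open>L\<close>, \<open>g\<close> serves both modules: \<open>g\<close> lies
  in the smaller function space and the equation has no solution even in the larger algebra.
  Cancellation of \<open>L\<close> is included for the argument against injectivity.\<close>

lemma unsolvable_diffop:
  fixes i j :: "'n::finite"
  assumes ij: "i \<noteq> j"
  obtains L :: "'n diffop" and g
  where "\<And>p. L * p = 0 \<Longrightarrow> p = 0" "g \<in> Cinf_T" "\<And>f. f \<in> adjoin_coords Cinf_PT \<Longrightarrow> act L f \<noteq> g"
proof -
  obtain \<alpha> :: real and p q :: "nat \<Rightarrow> int"
    where q: "inj q" "filterlim q at_top sequentially"
      and nz: "\<And>n. of_int (p n) - \<alpha> * of_int (q n) \<noteq> 0"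
      and fast: "\<And>r. summable (\<lambda>n. \<bar>of_int (p n) - \<alpha> * of_int (q n)\<bar> * (1 + \<bar>of_int (p n)\<bar> + \<bar>of_int (q n)\<bar>) ^ r)"
    by (rule liouville_approximation) blast
  define \<mu> where "\<mu> n = of_int (p n) - \<alpha> * of_int (q n)" for n
  define k :: "nat \<Rightarrow> real ^ 'n" where "k n = slice i j (of_int (p n)) (of_int (q n))" for n
  define g where "g = exp_series (\<lambda>n. of_real (\<mu> n)) k"
  define L :: "'n diffop" where "L = Poly_Mapping.single (Poly_Mapping.single i 1) 1
    + Poly_Mapping.single (Poly_Mapping.single j 1) (- of_real \<alpha>)"
  have "rapidly_decreasing (\<lambda>n. complex_of_real (\<mu> n)) k"
    unfolding rapidly_decreasing_def
  proof
    fix r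
    show "summable (\<lambda>n. norm (complex_of_real (\<mu> n)) * (1 + norm (k n)) ^ r)"
    proof (rule summable_comparison_test'[OF fast[of r], of 0])
      fix n
      have "norm (k n) \<le> \<bar>of_int (p n)\<bar> + \<bar>of_int (q n)\<bar>"
        unfolding k_def slice_def by (rule norm_triangle_le) simp
      then show "norm (norm (complex_of_real (\<mu> n)) * (1 + norm (k n)) ^ r)
          \<le> \<bar>of_int (p n) - \<alpha> * of_int (q n)\<bar> * (1 + \<bar>of_int (p n)\<bar> + \<bar>of_int (q n)\<bar>) ^ r"
        by (auto simp: abs_mult simp flip: \<mu>_def intro!: mult_left_mono power_mono)
    qed
  qed
  then have "g \<in> Cinf"
    unfolding g_def by (rule exp_series_Cinf)
  moreover have "periodic 1 g"
    unfolding periodic_def g_def exp_series_def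
  proof (intro allI arg_cong[of _ _ suminf] ext arg_cong2[of _ _ _ _ "(*)"] refl)
    fix l :: "int ^ 'n" and x and n
    let ?v = "\<chi> j. 2 * pi * real 1 * real_of_int (l $ j)"
    have "k n \<bullet> ?v = 2 * pi * of_int (p n * l $ i + q n * l $ j)"
      by (simp add: k_def slice_def inner_add_left inner_axis' algebra_simps)
    then have "cis (k n \<bullet> ?v) = 1"
      by (simp only: cis_multiple_2pi Ints_of_int)
    then show "cis (k n \<bullet> (x + ?v)) = cis (k n \<bullet> x)"
      by (simp add: inner_add_right cis_mult[symmetric])
  qed
  ultimately have "g \<in> Cinf_T" by (simp add: Cinf_T_def)
  moreover have "act L f \<noteq> g" if f: "f \<in> adjoin_coords Cinf_PT" for f
  proof
    assume L: "act L f = g"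
    have "(Cinf_PT :: (real ^ 'n \<Rightarrow> complex) set) \<subseteq> Cinf"
      by (auto simp: Cinf_PT_def)
    then have Cinf: "f \<in> Cinf"
      using subalgebra_Cinf_subset[OF subalgebra_adjoin_coords f] by blast
    have "D i f x - of_real \<alpha> * D j f x = g x" for x
      unfolding L[symmetric] by (simp add: L_def act_plus act_single D_monom_single[unfolded One_nat_def])
    moreover obtain N P where "slice_poly i j N P f"
      using slice_poly_adjoin_coords[OF ij f] by blast
    moreover have "summable (\<lambda>n. \<bar>\<mu> n\<bar>)"
      using fast[of 0] by (simp add: \<mu>_def)
    ultimately show False
      using no_slice_poly_solution[OF Cinf ij q nz, of N P] by (simp add: g_def k_def[abs_def] \<mu>_def)
  qed
  ultimately show ?thesis
    using that[of L g] diffop_nonzero_divisor[OF ij] unfolding L_def by blast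
qed

theorem theorem2p1:
  assumes "CARD('n::finite) > 1"
  shows "\<forall>A \<in> {Cinf_T, Cinf_PT :: (real ^ 'n \<Rightarrow> complex) set}.
    Module.module diffop_ring (diffop_module (adjoin_coords A)) \<and>
    \<not> divisible_module diffop_ring (diffop_module (adjoin_coords A)) \<and>
    \<not> injective_module TYPE('n diffop) diffop_ring (diffop_module (adjoin_coords A))"
proof
  fix A :: "(real ^ 'n \<Rightarrow> complex) set"
  assume A: "A \<in> {Cinf_T, Cinf_PT}"
  \<comment> \<open>The dimension bound enters here: two independent directions are needed for a
    small divisor.\<close>
  obtain i j :: 'n where ij: "i \<noteq> j"
    using assms card_le_Suc0_iff_eq[of "UNIV :: 'n set"] by (auto simp: not_le[symmetric])
  obtain L :: "'n diffop" and g where L: "\<And>p. L * p = 0 \<Longrightarrow> p = 0" and g: "g \<in> Cinf_T"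
    and no: "\<And>f. f \<in> adjoin_coords Cinf_PT \<Longrightarrow> act L f \<noteq> g"
    by (rule unsolvable_diffop[OF ij]) blast
  let ?E = "diffop_module (adjoin_coords A)"
  have "A \<subseteq> Cinf" "partial_deriv j f \<in> A" if "f \<in> A" for j f
    using A that periodic_partial_deriv Cinf_partial_deriv
    by (fastforce simp: Cinf_T_def Cinf_PT_def)+
  then have module: "Module.module diffop_ring ?E"
    using module_adjoin_coords[of A] A by (auto simp: Cinf_T_def Cinf_PT_def)
  \<comment> \<open>A solution in the smaller algebra would also be one in the larger, so
    unsolvability transfers downwards.\<close>
  have sub: "adjoin_coords A \<subseteq> adjoin_coords Cinf_PT"
    unfolding adjoin_coords_def by (rule hull_mono) (use A Cinf_T_subset in auto)
  have gE: "g \<in> carrier ?E"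
    using g A Cinf_T_subset adjoin_coords_superset[of A] by (auto simp: diffop_module_def)
  have unsolvable: "L \<odot>\<^bsub>?E\<^esub> f \<noteq> g" if "f \<in> carrier ?E" for f
    using no sub that by (auto simp: diffop_module_def)
  \<comment> \<open>If \<open>L\<close> were 0, cancellation applied to the constant 1 would give
    \<open>1 = 0\<close>.\<close>
  have "L \<noteq> 0" using L[of 1] by auto
  have "\<not> divisible_module diffop_ring ?E"
  proof
    assume "divisible_module diffop_ring ?E"
    moreover have "L \<in> carrier diffop_ring - {\<zero>\<^bsub>diffop_ring\<^esub>}"
      using \<open>L \<noteq> 0\<close> by (simp add: ring_of_type_algebra_def)
    ultimately have "(\<lambda>f. L \<odot>\<^bsub>?E\<^esub> f) ` carrier ?E = carrier ?E"
      unfolding divisible_module_def by blast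
    with gE have "g \<in> (\<lambda>f. L \<odot>\<^bsub>?E\<^esub> f) ` carrier ?E" by (simp only:)
    then obtain f where "g = L \<odot>\<^bsub>?E\<^esub> f" "f \<in> carrier ?E" by (rule imageE)
    with unsolvable[of f] show False by simp
  qed
  moreover have "\<not> injective_module TYPE('n diffop) diffop_ring ?E"
  proof
    assume "injective_module TYPE('n diffop) diffop_ring ?E"
    from injective_module_imp_solvable[OF this module L gE]
    obtain f where "f \<in> carrier ?E" "L \<odot>\<^bsub>?E\<^esub> f = g" by (rule bexE)
    with unsolvable[of f] show False by simp
  qed
  ultimately show "Module.module diffop_ring ?E \<and> \<not> divisible_module diffop_ring ?E \<and>
      \<not> injective_module TYPE('n diffop) diffop_ring ?E"
    using module by blast
qed

end
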